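(* Let $(X,g)$ be a compact Riemannian manifold. If $\chi_0$ and $\chi_1$ are two closed $1$-forms on $X$ in the same cohomology class $[\chi]\in H^1(X,\mathbb R)$ and the graphs in $T^*X$ of both of them are special Lagrangian submanifolds, then $\chi_0=\chi_1$.
   Context: For a closed $1$-form $\chi$ on $X$, let $\chi_{j,i}=D_i\chi_j$ denote its covariant derivative with respect to the Levi-Civita connection $D$ of $g$ and let $\eta_{ij}=g_{ij}+\chi_{k,i}g^{kl}\chi_{l,j}$. The graph $\Sigma_\chi=\{(x,\chi(x))\}\subset T^*X$ is a Lagrangian submanifold, and its Lagrangian angle $\theta(\chi)$ is given by $$e^{\sqrt{-1}\theta(\chi)}=\frac{\det(g_{ij}+\sqrt{-1}\chi_{j,i})}{\sqrt{\det g_{ij}}\sqrt{\det\eta_{ij}}},$$ with the branch $\theta(\chi)=\sum_i\arctan\lambda_i$, where $\lambda_i$ are the eigenvalues of the symmetric tensor $\chi_{j,i}$ with respect to $g$. The graph $\Sigma_\chi$ is called a special Lagrangian submanifold of $T^*X$ if $\theta(\chi)$ is constant on $X$. *)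

theory Defs
  imports "HOL-Analysis.Analysis"
begin

section \<open>Smooth maps between Euclidean spaces\<close>

text \<open>Both definitions below are meant for open sets \<open>S\<close>.\<close>

primrec Ck_on ::
  "nat \<Rightarrow> 'a::real_normed_vector set \<Rightarrow> ('a \<Rightarrow> 'b::real_normed_vector) \<Rightarrow> bool"
where
  "Ck_on 0 S f \<longleftrightarrow> continuous_on S f"
| "Ck_on (Suc k) S f \<longleftrightarrow>
     (\<forall>x\<in>S. f differentiable (at x)) \<and> (\<forall>v. Ck_on k S (\<lambda>x. frechet_derivative f (at x) v))"

definition smooth_on ::
  "'a::real_normed_vector set \<Rightarrow> ('a \<Rightarrow> 'b::real_normed_vector) \<Rightarrow> bool"
where "smooth_on S f \<longleftrightarrow> (\<forall>k. Ck_on k S f)"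

definition partial :: "'n::finite \<Rightarrow> (real^'n \<Rightarrow> real) \<Rightarrow> real^'n \<Rightarrow> real"
  where "partial i f x = frechet_derivative f (at x) (axis i 1)"


section \<open>Smooth manifolds\<close>

text \<open>A chart is a pair \<open>(U, \<phi>)\<close>; only the values of \<open>\<phi>\<close> on \<open>U\<close> matter.\<close>

type_synonym ('a, 'n) chart = "'a set \<times> ('a \<Rightarrow> real^'n)"

abbreviation chart_dom :: "('a, 'n::finite) chart \<Rightarrow> 'a set" where "chart_dom \<equiv> fst"
abbreviation chart_map :: "('a, 'n::finite) chart \<Rightarrow> 'a \<Rightarrow> real^'n" where "chart_map \<equiv> snd"

definition chart_img :: "('a, 'n::finite) chart \<Rightarrow> (real^'n) set"
  where "chart_img c = chart_map c ` chart_dom c"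

definition chart_inv :: "('a, 'n::finite) chart \<Rightarrow> real^'n \<Rightarrow> 'a"
  where "chart_inv c = inv_into (chart_dom c) (chart_map c)"

definition transition ::
  "('a, 'n::finite) chart \<Rightarrow> ('a, 'n) chart \<Rightarrow> real^'n \<Rightarrow> real^'n"
  where "transition c d = chart_map d \<circ> chart_inv c"

definition chart_on :: "'a topology \<Rightarrow> ('a, 'n::finite) chart \<Rightarrow> bool" where
  "chart_on X c \<longleftrightarrow> openin X (chart_dom c) \<and> open (chart_img c) \<and>
     homeomorphic_map (subtopology X (chart_dom c)) (top_of_set (chart_img c)) (chart_map c)"

text \<open>A manifold of dimension \<open>CARD('n)\<close>, without boundary and not assumed connected. The atlas
  is not required to be maximal.\<close>

definition smooth_manifold :: "'a topology \<Rightarrow> ('a, 'n::finite) chart set \<Rightarrow> bool" where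
  "smooth_manifold X A \<longleftrightarrow>
     Hausdorff_space X \<and> second_countable X \<and>
     (\<forall>c\<in>A. chart_on X c) \<and> (\<Union>c\<in>A. chart_dom c) = topspace X \<and>
     (\<forall>c\<in>A. \<forall>d\<in>A. smooth_on (chart_map c ` (chart_dom c \<inter> chart_dom d)) (transition c d))"

definition smooth_function :: "('a, 'n::finite) chart set \<Rightarrow> ('a \<Rightarrow> real) \<Rightarrow> bool"
  where "smooth_function A f \<longleftrightarrow> (\<forall>c\<in>A. smooth_on (chart_img c) (f \<circ> chart_inv c))"


section \<open>Tangent vectors\<close>

text \<open>A tangent vector at \<open>p\<close> is an equivalence class of pairs (chart at \<open>p\<close>, vector of
  \<open>real^'n\<close>), where \<open>(c, v)\<close> and \<open>(d, w)\<close> are equivalent if the derivative of the transition map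
  sends \<open>v\<close> to \<open>w\<close>. Such a class contains exactly one pair for each chart at \<open>p\<close>, so it is encoded
  as the function that sends each chart at \<open>p\<close> to the representing vector (and all
  else to \<open>0\<close>).\<close>

type_synonym ('a, 'n) tvec = "('a, 'n) chart \<Rightarrow> real^'n"

definition tangent_space :: "('a, 'n::finite) chart set \<Rightarrow> 'a \<Rightarrow> ('a, 'n) tvec set" where
  "tangent_space A p =
     {\<xi>. (\<forall>c. \<not> (c \<in> A \<and> p \<in> chart_dom c) \<longrightarrow> \<xi> c = 0) \<and>
         (\<forall>c\<in>A. \<forall>d\<in>A. p \<in> chart_dom c \<inter> chart_dom d \<longrightarrow>
            \<xi> d = frechet_derivative (transition c d) (at (chart_map c p)) (\<xi> c))}"

definition tvec_comb ::
  "real \<Rightarrow> ('a, 'n::finite) tvec \<Rightarrow> real \<Rightarrow> ('a, 'n) tvec \<Rightarrow> ('a, 'n) tvec"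
  where "tvec_comb a \<xi> b \<zeta> = (\<lambda>c. a *\<^sub>R \<xi> c + b *\<^sub>R \<zeta> c)"

text \<open>The coordinate vector \<open>\<partial>\<^sub>i\<close> of the chart \<open>c\<close> at the point \<open>p\<close>:\<close>

definition coord_vec ::
  "('a, 'n::finite) chart set \<Rightarrow> ('a, 'n) chart \<Rightarrow> 'a \<Rightarrow> 'n \<Rightarrow> ('a, 'n) tvec"
where
  "coord_vec A c p i = (\<lambda>d. if d \<in> A \<and> p \<in> chart_dom d
     then frechet_derivative (transition c d) (at (chart_map c p)) (axis i 1) else 0)"


section \<open>Riemannian metrics and the Levi-Civita connection\<close>

type_synonym ('a, 'n) bilinear_field = "'a \<Rightarrow> ('a, 'n) tvec \<Rightarrow> ('a, 'n) tvec \<Rightarrow> real"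

definition metric_comp ::
  "('a, 'n::finite) chart set \<Rightarrow> ('a, 'n) chart \<Rightarrow> ('a, 'n) bilinear_field \<Rightarrow> real^'n \<Rightarrow> real^'n^'n"
where
  "metric_comp A c g x =
     (\<chi> i j. g (chart_inv c x) (coord_vec A c (chart_inv c x) i) (coord_vec A c (chart_inv c x) j))"

definition riemannian_metric ::
  "'a topology \<Rightarrow> ('a, 'n::finite) chart set \<Rightarrow> ('a, 'n) bilinear_field \<Rightarrow> bool"
where
  "riemannian_metric X A g \<longleftrightarrow>
     (\<forall>p\<in>topspace X. \<forall>\<xi>\<in>tangent_space A p.
        (\<forall>\<zeta>\<in>tangent_space A p. g p \<xi> \<zeta> = g p \<zeta> \<xi>) \<and>
        (\<forall>\<zeta>\<in>tangent_space A p. \<forall>\<omega>\<in>tangent_space A p. \<forall>a b.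
           g p \<xi> (tvec_comb a \<zeta> b \<omega>) = a * g p \<xi> \<zeta> + b * g p \<xi> \<omega>) \<and>
        (\<xi> \<noteq> (\<lambda>c. 0) \<longrightarrow> g p \<xi> \<xi> > 0)) \<and>
     (\<forall>c\<in>A. \<forall>i j. smooth_on (chart_img c) (\<lambda>x. metric_comp A c g x $ i $ j))"

definition compact_riemannian_manifold ::
  "'a topology \<Rightarrow> ('a, 'n::finite) chart set \<Rightarrow> ('a, 'n) bilinear_field \<Rightarrow> bool"
where
  "compact_riemannian_manifold X A g \<longleftrightarrow>
     smooth_manifold X A \<and> compact_space X \<and> riemannian_metric X A g"

text \<open>The connection coefficients \<open>\<Gamma>\<^sup>k\<^sub>i\<^sub>j\<close>, with \<open>D\<^sub>i \<partial>\<^sub>j = \<Sum>k. \<Gamma>\<^sup>k\<^sub>i\<^sub>j \<partial>\<^sub>k\<close>, of the Levi-Civita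
  connection of a metric with component matrix \<open>G\<close>:\<close>

definition christoffel ::
  "(real^'n::finite \<Rightarrow> real^'n^'n) \<Rightarrow> 'n \<Rightarrow> 'n \<Rightarrow> 'n \<Rightarrow> real^'n \<Rightarrow> real"
where
  "christoffel G k i j x = (1/2) * (\<Sum>l\<in>UNIV. matrix_inv (G x) $ k $ l *
     (partial i (\<lambda>y. G y $ j $ l) x + partial j (\<lambda>y. G y $ i $ l) x
      - partial l (\<lambda>y. G y $ i $ j) x))"

text \<open>They are the unique coefficients of a torsion-free connection that is compatible with
  the metric:\<close>

lemma christoffel_levi_civita:
  fixes G :: "real^'n::finite \<Rightarrow> real^'n^'n" and \<Gamma> :: "'n \<Rightarrow> 'n \<Rightarrow> 'n \<Rightarrow> real"
  assumes S: "open S" "x \<in> S"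
    and sym: "\<And>y i j. y \<in> S \<Longrightarrow> G y $ i $ j = G y $ j $ i"
    and inv: "invertible (G x)"
  shows "(\<forall>k i j. \<Gamma> k i j = \<Gamma> k j i) \<and>
         (\<forall>l i j. partial l (\<lambda>y. G y $ i $ j) x =
            (\<Sum>k\<in>UNIV. \<Gamma> k l i * G x $ k $ j) + (\<Sum>k\<in>UNIV. \<Gamma> k l j * G x $ i $ k))
         \<longleftrightarrow> (\<forall>k i j. \<Gamma> k i j = christoffel G k i j x)"
proof -
  define P where "P l i j = partial l (\<lambda>y. G y $ i $ j) x" for l i j
  define L where "L \<Gamma> m i j = (\<Sum>k\<in>UNIV. G x $ m $ k * \<Gamma> k i j)"
    for \<Gamma> :: "'n \<Rightarrow> 'n \<Rightarrow> 'n \<Rightarrow> real" and m i j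
  define C where "C k i j = christoffel G k i j x" for k i j
  have symx: "G x $ i $ j = G x $ j $ i" for i j
    using sym S by blast
  have Psym: "P l i j = P l j i" for l i j
  proof -
    have imp: "((\<lambda>y. G y $ j $ i) has_derivative D) (at x)"
      if "((\<lambda>y. G y $ i $ j) has_derivative D) (at x)" for i j D
      by (rule has_derivative_transform_within_open[OF that S]) (rule sym)
    have "((\<lambda>y. G y $ i $ j) has_derivative D) (at x) \<longleftrightarrow>
          ((\<lambda>y. G y $ j $ i) has_derivative D) (at x)" for D
      by (rule iffI; erule imp)
    then show ?thesis by (simp only: P_def partial_def frechet_derivative_def)
  qed
  have inv1: "G x ** matrix_inv (G x) = mat 1" and inv2: "matrix_inv (G x) ** G x = mat 1"
    using inv someI_ex[of "\<lambda>B. G x ** B = mat 1 \<and> B ** G x = mat 1"]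
    unfolding invertible_def matrix_inv_def by blast+
  have entry: "(\<Sum>k\<in>UNIV. A $ i $ k * B $ k $ j) = (if i = j then 1 else 0)"
    if "A ** B = mat 1" for A B :: "real^'n^'n" and i j
    using arg_cong[OF that, of "\<lambda>M. M $ i $ j"] by (simp add: matrix_matrix_mult_def mat_def)
  have recover: "(\<Sum>k\<in>UNIV. A $ i $ k * (\<Sum>l\<in>UNIV. B $ k $ l * f l)) = f i"
    if "A ** B = mat 1" for A B :: "real^'n^'n" and i f
  proof -
    have "(\<Sum>k\<in>UNIV. A $ i $ k * (\<Sum>l\<in>UNIV. B $ k $ l * f l))
        = (\<Sum>l\<in>UNIV. (\<Sum>k\<in>UNIV. A $ i $ k * B $ k $ l) * f l)"
      by (simp add: sum_distrib_left sum_distrib_right mult.assoc) (rule sum.swap)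
    also have "\<dots> = (\<Sum>l\<in>UNIV. if i = l then f l else 0)"
      by (rule sum.cong) (auto simp: entry[OF that])
    finally show ?thesis by simp
  qed
  have C_alt: "C k i j = (\<Sum>l\<in>UNIV. matrix_inv (G x) $ k $ l * ((P i j l + P j i l - P l i j) / 2))"
    for k i j
    by (simp add: C_def christoffel_def P_def sum_distrib_left mult_ac)
  have LC: "L C m i j = (P i j m + P j i m - P m i j) / 2" for m i j
    unfolding L_def C_alt by (rule recover[OF inv1])
  have from_L: "\<Gamma> k i j = (\<Sum>l\<in>UNIV. matrix_inv (G x) $ k $ l * L \<Gamma> l i j)" for k i j
    unfolding L_def by (rule recover[OF inv2, symmetric])
  have compat: "(\<Sum>k\<in>UNIV. \<Gamma> k l i * G x $ k $ j) + (\<Sum>k\<in>UNIV. \<Gamma> k l j * G x $ i $ k)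
      = L \<Gamma> j l i + L \<Gamma> i l j" for l i j
    unfolding L_def by (simp only: symx[of _ j] mult.commute[of "G x $ _ $ _"])
  have "(\<forall>k i j. \<Gamma> k i j = \<Gamma> k j i) \<and> (\<forall>l i j. P l i j = L \<Gamma> j l i + L \<Gamma> i l j)
      \<longleftrightarrow> (\<forall>k i j. \<Gamma> k i j = C k i j)"
  proof safe
    fix k i j
    assume s: "\<forall>k i j. \<Gamma> k i j = \<Gamma> k j i" and m: "\<forall>l i j. P l i j = L \<Gamma> j l i + L \<Gamma> i l j"
    have Ls: "L \<Gamma> m i j = L \<Gamma> m j i" for m i j
      unfolding L_def using s by metis
    have "L \<Gamma> l i j = (P i j l + P j i l - P l i j) / 2" for l
      using m Ls[of l i j] Ls[of j l i] Ls[of i l j] by simp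
    then show "\<Gamma> k i j = C k i j"
      by (simp only: from_L[of k i j] C_alt)
  next
    fix k i j assume "\<forall>k i j. \<Gamma> k i j = C k i j"
    moreover have "C k i j = C k j i"
      by (simp only: C_alt Psym[of _ j i] add.commute[of "P j i _"])
    ultimately show "\<Gamma> k i j = \<Gamma> k j i" by simp
  next
    fix l i j assume "\<forall>k i j. \<Gamma> k i j = C k i j"
    then have e: "L \<Gamma> m i j = L C m i j" for m i j
      by (simp add: L_def)
    show "P l i j = L \<Gamma> j l i + L \<Gamma> i l j"
      unfolding e LC using Psym[of l j i] by (simp add: field_simps)
  qed
  then show ?thesis unfolding P_def C_def compat .
qed


section \<open>One-forms and first de Rham cohomology\<close>

type_synonym ('a, 'n) form = "'a \<Rightarrow> ('a, 'n) tvec \<Rightarrow> real"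

definition form_comp ::
  "('a, 'n::finite) chart set \<Rightarrow> ('a, 'n) chart \<Rightarrow> ('a, 'n) form \<Rightarrow> real^'n \<Rightarrow> real^'n"
where
  "form_comp A c \<omega> x = (\<chi> i. \<omega> (chart_inv c x) (coord_vec A c (chart_inv c x) i))"

text \<open>A form is required to vanish outside the tangent bundle, so that equality of forms is
  equality of HOL functions.\<close>

definition one_form :: "'a topology \<Rightarrow> ('a, 'n::finite) chart set \<Rightarrow> ('a, 'n) form \<Rightarrow> bool" where
  "one_form X A \<omega> \<longleftrightarrow>
     (\<forall>p \<xi>. \<not> (p \<in> topspace X \<and> \<xi> \<in> tangent_space A p) \<longrightarrow> \<omega> p \<xi> = 0) \<and>
     (\<forall>p\<in>topspace X. \<forall>\<xi>\<in>tangent_space A p. \<forall>\<zeta>\<in>tangent_space A p. \<forall>a b.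
        \<omega> p (tvec_comb a \<xi> b \<zeta>) = a * \<omega> p \<xi> + b * \<omega> p \<zeta>) \<and>
     (\<forall>c\<in>A. \<forall>i. smooth_on (chart_img c) (\<lambda>x. form_comp A c \<omega> x $ i))"

definition closed_one_form :: "'a topology \<Rightarrow> ('a, 'n::finite) chart set \<Rightarrow> ('a, 'n) form \<Rightarrow> bool"
where
  "closed_one_form X A \<omega> \<longleftrightarrow> one_form X A \<omega> \<and>
     (\<forall>c\<in>A. \<forall>x\<in>chart_img c. \<forall>i j.
        partial i (\<lambda>y. form_comp A c \<omega> y $ j) x - partial j (\<lambda>y. form_comp A c \<omega> y $ i) x = 0)"

text \<open>\<open>\<omega> = df\<close>, evaluated on each tangent vector in every chart:\<close>

definition is_differential ::
  "('a, 'n::finite) chart set \<Rightarrow> ('a \<Rightarrow> real) \<Rightarrow> ('a, 'n) form \<Rightarrow> bool"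
where
  "is_differential A f \<omega> \<longleftrightarrow>
     (\<forall>c\<in>A. \<forall>p\<in>chart_dom c. \<forall>\<xi>\<in>tangent_space A p.
        \<omega> p \<xi> = frechet_derivative (f \<circ> chart_inv c) (at (chart_map c p)) (\<xi> c))"

definition cohomologous ::
  "'a topology \<Rightarrow> ('a, 'n::finite) chart set \<Rightarrow> (('a, 'n) form \<times> ('a, 'n) form) set"
where
  "cohomologous X A = {(\<omega>, \<omega>'). closed_one_form X A \<omega> \<and> closed_one_form X A \<omega>' \<and>
     (\<exists>f. smooth_function A f \<and> is_differential A f (\<lambda>p \<xi>. \<omega>' p \<xi> - \<omega> p \<xi>))}"

definition deRham_H1 ::
  "'a topology \<Rightarrow> ('a, 'n::finite) chart set \<Rightarrow> ('a, 'n) form set set"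
where "deRham_H1 X A = {\<omega>. closed_one_form X A \<omega>} // cohomologous X A"


section \<open>Lagrangian angle\<close>

text \<open>The entry with indices \<open>j\<close>, \<open>i\<close> is
  \<open>\<omega>\<^sub>j\<^sub>,\<^sub>i = D\<^sub>i \<omega>\<^sub>j = \<partial>\<^sub>i \<omega>\<^sub>j - (\<Sum>k. \<Gamma>\<^sup>k\<^sub>i\<^sub>j \<omega>\<^sub>k)\<close>, where \<open>w\<close> are the components of \<open>\<omega>\<close>.\<close>

definition cov_deriv ::
  "(real^'n::finite \<Rightarrow> real^'n^'n) \<Rightarrow> (real^'n \<Rightarrow> real^'n) \<Rightarrow> real^'n \<Rightarrow> real^'n^'n"
 
where
  "cov_deriv G w x =
     (\<chi> j i. partial i (\<lambda>y. w y $ j) x - (\<Sum>k\<in>UNIV. christoffel G k i j x * w x $ k))"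

text \<open>Eigenspaces and eigenvalues of a symmetric bilinear form \<open>S\<close> with respect to an inner product
  \<open>G\<close>. As \<open>S\<close> is diagonalizable with respect to \<open>G\<close>, the multiplicity of an eigenvalue is the
  dimension of its eigenspace.\<close>

definition rel_eigenspace :: "real^'n^'n \<Rightarrow> real^'n^'n \<Rightarrow> real \<Rightarrow> (real^'n::finite) set"
  where "rel_eigenspace G S l = {v. S *v v = l *\<^sub>R (G *v v)}"

definition rel_eigenvalues :: "real^'n^'n \<Rightarrow> real^'n::finite^'n \<Rightarrow> real set"
  where "rel_eigenvalues G S = {l. \<exists>v \<in> rel_eigenspace G S l. v \<noteq> 0}"

text \<open>The Lagrangian angle \<open>\<theta>\<close> of the graph of \<open>\<omega>\<close> at the point with coordinates \<open>x\<close> in the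
  chart \<open>c\<close>, i.e. the sum of \<open>arctan \<lambda>\<^sub>i\<close> with the eigenvalues \<open>\<lambda>\<^sub>i\<close> repeated according to
  multiplicity.\<close>

definition lagrangian_angle ::
  "('a, 'n::finite) chart set \<Rightarrow> ('a, 'n) bilinear_field \<Rightarrow> ('a, 'n) form \<Rightarrow> ('a, 'n) chart \<Rightarrow> real^'n \<Rightarrow> real"
where
  "lagrangian_angle A g \<omega> c x =
     (let G = metric_comp A c g; S = cov_deriv G (form_comp A c \<omega>) x
      in \<Sum>l\<in>rel_eigenvalues (G x) S. real (dim (rel_eigenspace (G x) S l)) * arctan l)"

text \<open>The angle at a point does not depend on the chart in which it is computed, as all the objects
  involved are tensorial; hence \<open>\<theta>\<close> is constant on the manifold iff one number is its value at all
  points of all charts.\<close>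

definition special_lagrangian_graph ::
  "('a, 'n::finite) chart set \<Rightarrow> ('a, 'n) bilinear_field \<Rightarrow> ('a, 'n) form \<Rightarrow> bool"
where
  "special_lagrangian_graph A g \<omega> \<longleftrightarrow>
     (\<exists>\<theta>. \<forall>c\<in>A. \<forall>x\<in>chart_img c. lagrangian_angle A g \<omega> c x = \<theta>)"

end

theory Submission
  imports Defs
begin

text \<open>Write \<open>\<chi>\<^sub>1 - \<chi>\<^sub>0 = df\<close>. Along the segment joining the symmetric tensors
  \<open>D\<chi>\<^sub>0\<close> and \<open>D\<chi>\<^sub>1\<close> the angle is differentiable, with derivative
  \<open>\<Sum>\<^sub>j H(v\<^sub>j, v\<^sub>j) / (1 + \<lambda>\<^sub>j\<^sup>2)\<close> where \<open>H = D df\<close> and \<open>v\<^sub>j\<close> is a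
  \<open>g\<close>-orthonormal eigenbasis at the point of the segment. At a maximum of \<open>f\<close> this shows that
  the angle of \<open>\<chi>\<^sub>1\<close> is at most that of \<open>\<chi>\<^sub>0\<close>; at a minimum the reverse holds, so the two
  constants agree. The mean value theorem then turns the equality of the angles into a linear elliptic
  equation for \<open>f\<close> without zeroth-order term whose coefficients are locally bounded and locally
  uniformly elliptic (no continuity is needed), and Hopf's strong maximum principle makes \<open>f\<close>
  constant on each connected component.\<close>

section \<open>Eigenbases relative to an inner product\<close>

text \<open>The angle is a sum over the set of eigenvalues weighted by dimensions of eigenspaces,
  and these data need not vary differentiably with the tensor where eigenvalues collide. The
  determinant of G + i S is polynomial in S and carries the same phase: a congruence by an
  eigenbasis multiplies it by a positive real and turns it into the product of the 1 + i lambda_j,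
  so its logarithmic derivative produces the weights 1 / (1 + lambda_j^2). The intermediate tensor
  given by the mean value theorem, and its eigenbasis, change from point to point without control.
  Hence the elliptic equation is never written with a coefficient matrix: at each point only a
  finite family u_j with sum of H(u_j, u_j) equal to 0 is kept, with uniform bounds on the lengths
  of the u_j and on how strongly they span, and the maximum principle is formulated for such
  families. In coordinates H(u, u) is the second derivative of f in direction u minus df applied to
  the Christoffel vector of u, which is the whole first-order term.\<close>

lemma symmetric_matrix_inner_commute:
  fixes S :: "real^'n^'n"
  assumes "transpose S = S"
  shows "x \<bullet> (S *v y) = y \<bullet> (S *v x)"
  by (metis assms dot_lmul_matrix inner_commute vector_transpose_matrix)

definition pos_def_matrix :: "real^'n^'n \<Rightarrow> bool" where
  "pos_def_matrix G \<longleftrightarrow> transpose G = G \<and> (\<forall>v. v \<noteq> 0 \<longrightarrow> v \<bullet> (G *v v) > 0)"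

text \<open>Indexing by \<open>'n\<close> repeats every eigenvalue according to its multiplicity, so
  the angle will become a plain sum over indices.\<close>

definition rel_eigenbasis ::
  "real^'n^'n \<Rightarrow> real^'n^'n \<Rightarrow> ('n::finite \<Rightarrow> real^'n) \<Rightarrow> ('n \<Rightarrow> real) \<Rightarrow> bool" where
  "rel_eigenbasis G S v l \<longleftrightarrow>
     (\<forall>i j. v i \<bullet> (G *v v j) = (if i = j then 1 else 0)) \<and> (\<forall>i. S *v v i = l i *\<^sub>R (G *v v i))"

text \<open>First variation in algebraic form: for small \<open>t\<close> of the sign opposite to
  \<open>a\<close> the linear term wins. It replaces differentiation of the Rayleigh quotient at its
  maximizer.\<close>

lemma nonneg_quadratic_linear_coeff_zero:
  fixes a b :: real
  assumes "\<And>t. t * a + t\<^sup>2 * b \<ge> 0"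
  shows "a = 0"
proof (rule ccontr)
  assume a: "a \<noteq> 0"
  define k where "k = \<bar>b\<bar> + 1"
  have k: "k > 0" "b < k" by (auto simp: k_def)
  have "(- a / k) * a + (- a / k)\<^sup>2 * b = a\<^sup>2 / k\<^sup>2 * (b - k)"
    using k by (simp add: field_simps power2_eq_square)
  also have "\<dots> < 0" using a k by (intro mult_pos_neg) auto
  finally show False using assms[of "- a / k"] by simp
qed

text \<open>The new eigenvector maximizes the Rayleigh quotient on the \<open>G\<close>-orthogonal complement of \<open>B\<close>.\<close>

lemma exists_rel_eigenvector_orthogonal:
  fixes G S :: "real^'n^'n"
  assumes G: "pos_def_matrix G" and S: "transpose S = S"
    and B: "finite B" "card B < CARD('n)"
    and orth: "\<And>b c. b \<in> B \<Longrightarrow> c \<in> B \<Longrightarrow> b \<bullet> (G *v c) = (if b = c then 1 else 0)"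
    and eig: "\<And>b. b \<in> B \<Longrightarrow> \<exists>l. S *v b = l *\<^sub>R (G *v b)"
  shows "\<exists>w l. w \<bullet> (G *v w) = 1 \<and> (\<forall>b\<in>B. w \<bullet> (G *v b) = 0) \<and> S *v w = l *\<^sub>R (G *v w)"
proof -
  have Gs: "x \<bullet> (G *v y) = y \<bullet> (G *v x)" for x y
    using G symmetric_matrix_inner_commute by (auto simp: pos_def_matrix_def)
  have Gpos: "v \<bullet> (G *v v) > 0" if "v \<noteq> 0" for v
    using G that by (auto simp: pos_def_matrix_def)
  define W where "W = {w. \<forall>b\<in>B. w \<bullet> (G *v b) = 0}"
  have subW: "subspace W"
    by (auto simp: W_def subspace_def inner_add_left)
  have "dim ((*v) G ` B) < DIM(real^'n)"
    using B dim_le_card'[of "(*v) G ` B"] card_image_le[of B "(*v) G"] by simp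
  then obtain y where y: "y \<noteq> 0" "\<And>z. z \<in> span ((*v) G ` B) \<Longrightarrow> orthogonal y z"
    using orthogonal_to_subspace_exists by blast
  have yW: "y \<in> W"
    using y(2) by (auto simp: W_def orthogonal_def intro: span_base)
  define R where "R w = (w \<bullet> (S *v w)) / (w \<bullet> (G *v w))" for w
  let ?C = "W \<inter> sphere 0 1"
  have "compact ?C" using subW by (simp add: closed_Int_compact closed_subspace)
  moreover have "y /\<^sub>R norm y \<in> ?C"
    using y(1) yW subW by (auto simp: subspace_scale)
  moreover have "continuous_on ?C R"
  proof -
    have "w \<bullet> (G *v w) \<noteq> 0" if "w \<in> ?C" for w
      using Gpos[of w] that by force
    then show ?thesis unfolding R_def by (intro continuous_intros) auto
  qed
  ultimately obtain w where w: "w \<in> ?C" and wmax: "\<And>u. u \<in> ?C \<Longrightarrow> R u \<le> R w"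
    using continuous_attains_sup[of ?C R] by blast
  define \<mu> where "\<mu> = R w"
  have w0: "w \<noteq> 0" "w \<in> W" using w by auto
  \<comment> \<open>The defect of the eigenvalue equation for \<open>w\<close>. It is orthogonal to
    \<open>W\<close> by the first variation and to \<open>B\<close> because \<open>B\<close>
    consists of eigenvectors; together these leave only \<open>e = 0\<close>.\<close>
  define e where "e = \<mu> *\<^sub>R (G *v w) - S *v w"
  have quad: "\<mu> * (u \<bullet> (G *v u)) - u \<bullet> (S *v u) \<ge> 0" if "u \<in> W" for u
  proof (cases "u = 0")
    case False
    have "R (u /\<^sub>R norm u) \<le> \<mu>"
      unfolding \<mu>_def using that False subW by (intro wmax) (auto simp: subspace_scale)
    moreover have "R (u /\<^sub>R norm u) = R u"
      using False by (simp add: R_def matrix_vector_mult_scaleR)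
    ultimately have "(u \<bullet> (S *v u)) / (u \<bullet> (G *v u)) \<le> \<mu>" by (simp add: R_def)
    then show ?thesis using Gpos[OF False] by (simp add: field_simps)
  qed simp
  have quad0: "\<mu> * (w \<bullet> (G *v w)) - w \<bullet> (S *v w) = 0"
    using Gpos[OF w0(1)] by (simp add: \<mu>_def R_def)
  have eW: "u \<bullet> e = 0" if "u \<in> W" for u
  proof -
    have "0 \<le> t * (2 * (u \<bullet> e)) + t\<^sup>2 * (\<mu> * (u \<bullet> (G *v u)) - u \<bullet> (S *v u))" for t
    proof -
      have "w + t *\<^sub>R u \<in> W" using that w0(2) subW by (simp add: subspace_add subspace_scale)
      from quad[OF this] quad0 Gs[of u w] symmetric_matrix_inner_commute[OF S, of u w] show ?thesis
        by (simp add: e_def inner_add_left inner_add_right inner_diff_right matrix_vector_mult_scaleR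
            matrix_vector_right_distrib algebra_simps power2_eq_square)
    qed
    then have "2 * (u \<bullet> e) = 0" by (rule nonneg_quadratic_linear_coeff_zero)
    then show ?thesis by simp
  qed
  have eB: "b \<bullet> e = 0" if b: "b \<in> B" for b
  proof -
    obtain l where l: "S *v b = l *\<^sub>R (G *v b)" using eig[OF b] by blast
    have "w \<bullet> (G *v b) = 0" using w0(2) b by (auto simp: W_def)
    then show ?thesis
      using l Gs[of b w] symmetric_matrix_inner_commute[OF S, of b w] by (simp add: e_def inner_diff_right)
  qed
  have "e \<bullet> e = 0"
  proof -
    \<comment> \<open>The \<open>G\<close>-orthogonal projection of \<open>e\<close> onto the span
      of \<open>B\<close>; subtracting it moves \<open>e\<close> into \<open>W\<close>.\<close>
    define p where "p = (\<Sum>b\<in>B. (e \<bullet> (G *v b)) *\<^sub>R b)"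
    have "e - p \<in> W"
    proof -
      have "p \<bullet> (G *v c) = e \<bullet> (G *v c)" if "c \<in> B" for c
      proof -
        have "p \<bullet> (G *v c) = (\<Sum>b\<in>B. (e \<bullet> (G *v b)) * (if b = c then 1 else 0))"
          unfolding p_def inner_sum_left using that by (intro sum.cong) (auto simp: orth)
        also have "\<dots> = e \<bullet> (G *v c)" using that B by (simp add: if_distrib cong: if_cong)
        finally show ?thesis .
      qed
      then show ?thesis by (simp add: W_def inner_diff_left)
    qed
    then have "(e - p) \<bullet> e = 0" by (rule eW)
    moreover have "p \<bullet> e = 0" by (simp add: p_def inner_sum_left eB)
    ultimately show ?thesis by (simp add: inner_diff_left)
  qed
  then have Sw: "S *v w = \<mu> *\<^sub>R (G *v w)" by (simp add: e_def)
  define c where "c = inverse (sqrt (w \<bullet> (G *v w)))"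
  have "(c *\<^sub>R w) \<bullet> (G *v (c *\<^sub>R w)) = 1"
    using Gpos[OF w0(1)] by (simp add: c_def matrix_vector_mult_scaleR field_simps)
  moreover have "\<forall>b\<in>B. (c *\<^sub>R w) \<bullet> (G *v b) = 0" using w0(2) by (simp add: W_def)
  moreover have "S *v (c *\<^sub>R w) = \<mu> *\<^sub>R (G *v (c *\<^sub>R w))"
    by (simp add: Sw matrix_vector_mult_scaleR)
  ultimately show ?thesis by blast
qed

text \<open>Induction on the size of a \<open>G\<close>-orthonormal set of eigenvectors. Sets carry
  the induction; a bijection with \<open>'n\<close> turns the full one into an indexed
  family.\<close>

lemma exists_rel_eigenbasis:
  fixes G S :: "real^'n^'n"
  assumes G: "pos_def_matrix G" and S: "transpose S = S"
  obtains v l where "rel_eigenbasis G S v l"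
proof -
  have Gs: "x \<bullet> (G *v y) = y \<bullet> (G *v x)" for x y
    using G symmetric_matrix_inner_commute by (auto simp: pos_def_matrix_def)
  have ex: "\<exists>B. finite B \<and> card B = k \<and> (\<forall>b\<in>B. \<forall>c\<in>B. b \<bullet> (G *v c) = (if b = c then 1 else 0)) \<and>
      (\<forall>b\<in>B. \<exists>l. S *v b = l *\<^sub>R (G *v b))" if "k \<le> CARD('n)" for k
    using that
  proof (induction k)
    case (Suc k)
    then obtain B where B: "finite B" "card B = k"
        "\<forall>b\<in>B. \<forall>c\<in>B. b \<bullet> (G *v c) = (if b = c then 1 else 0)" "\<forall>b\<in>B. \<exists>l. S *v b = l *\<^sub>R (G *v b)"
      by auto
    obtain w l where w: "w \<bullet> (G *v w) = 1" "\<forall>b\<in>B. w \<bullet> (G *v b) = 0" "S *v w = l *\<^sub>R (G *v w)"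
      using exists_rel_eigenvector_orthogonal[OF G S B(1)] B Suc.prems by force
    have "w \<notin> B" using w by auto
    moreover have "\<forall>b\<in>B. b \<bullet> (G *v w) = 0" using w(2) by (metis Gs)
    ultimately show ?case
      using B w by (intro exI[of _ "insert w B"]) auto
  qed auto
  from ex[OF order_refl] obtain B where "finite B \<and> card B = CARD('n) \<and>
      (\<forall>b\<in>B. \<forall>c\<in>B. b \<bullet> (G *v c) = (if b = c then 1 else 0)) \<and>
      (\<forall>b\<in>B. \<exists>l. S *v b = l *\<^sub>R (G *v b))" ..
  then have B: "finite B" "card B = CARD('n)"
      "\<forall>b\<in>B. \<forall>c\<in>B. b \<bullet> (G *v c) = (if b = c then 1 else 0)"
      "\<forall>b\<in>B. \<exists>l. S *v b = l *\<^sub>R (G *v b)"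
    by simp_all
  obtain v :: "'n \<Rightarrow> real^'n" where v: "bij_betw v UNIV B"
    using finite_same_card_bij[of "UNIV :: 'n set" B] B by auto
  then have vB: "v i \<in> B" and inj: "v i = v j \<longleftrightarrow> i = j" for i j
    by (auto simp: bij_betw_def inj_def)
  have "\<forall>i. \<exists>l. S *v v i = l *\<^sub>R (G *v v i)" using B(4) vB by simp
  from choice[OF this] obtain l where l: "\<forall>i. S *v v i = l i *\<^sub>R (G *v v i)" ..
  have "v i \<bullet> (G *v v j) = (if i = j then 1 else 0)" for i j
    using B(3) vB inj by simp
  with l have "rel_eigenbasis G S v l" by (simp add: rel_eigenbasis_def)
  then show ?thesis by (rule that)
qed

abbreviation col_matrix :: "('n::finite \<Rightarrow> real^'n) \<Rightarrow> real^'n^'n" where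
  "col_matrix v \<equiv> (\<chi> r i. v i $ r)"

lemma congruence_entry:
  "(transpose (col_matrix v) ** (M ** col_matrix v)) $ i $ j = v i \<bullet> (M *v v j)"
  by (simp add: matrix_matrix_mult_def transpose_def inner_vec_def matrix_vector_mult_def)

lemma rel_eigenbasis_congruence:
  assumes "rel_eigenbasis G S v l"
  shows "transpose (col_matrix v) ** (G ** col_matrix v) = mat 1"
  using assms by (simp add: vec_eq_iff congruence_entry rel_eigenbasis_def mat_def)

text \<open>With \<open>V\<close> the matrix of columns \<open>v\<close>, orthonormality says that
  the transpose of \<open>V\<close> times \<open>G\<close> inverts \<open>V\<close> on one side,
  hence on both sides as the matrices are square.\<close>

lemma rel_eigenbasis_expand:
  assumes "rel_eigenbasis G S v l"
  shows "x = (\<Sum>i\<in>UNIV. (v i \<bullet> (G *v x)) *\<^sub>R v i)"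
proof -
  let ?V = "col_matrix v"
  have "?V ** (transpose ?V ** G) = mat 1"
    using rel_eigenbasis_congruence[OF assms] matrix_left_right_inverse
    by (metis matrix_mul_assoc)
  then have "x = ?V *v (transpose ?V *v (G *v x))"
    by (metis matrix_vector_mul_assoc matrix_vector_mul_lid)
  also have "transpose ?V *v (G *v x) = (\<chi> i. v i \<bullet> (G *v x))"
    by (simp add: vec_eq_iff matrix_vector_mult_def transpose_def inner_vec_def)
  also have "?V *v \<dots> = (\<Sum>i\<in>UNIV. (v i \<bullet> (G *v x)) *\<^sub>R v i)"
    by (simp add: vec_eq_iff matrix_vector_mult_def mult.commute)
  finally show ?thesis .
qed

text \<open>The expansion makes the range of \<open>v\<close> spanning; it has at most
  \<open>CARD('n)\<close> elements, so counting forces both independence and injectivity.\<close>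

lemma rel_eigenbasis_independent:
  fixes v :: "'n::finite \<Rightarrow> real^'n"
  assumes "rel_eigenbasis G S v l"
  shows "inj v" "independent (range v)"
proof -
  have span: "UNIV \<subseteq> span (range v)"
  proof
    fix x
    have "(\<Sum>i\<in>UNIV. (v i \<bullet> (G *v x)) *\<^sub>R v i) \<in> span (range v)"
      by (intro span_sum span_mul span_base) auto
    then show "x \<in> span (range v)" using rel_eigenbasis_expand[OF assms, of x] by simp
  qed
  have le: "card (range v) \<le> CARD('n)" by (simp add: card_image_le)
  then show ind: "independent (range v)"
    using card_le_dim_spanning[of "range v" UNIV] span by simp
  have "card (range v) = CARD('n)"
    using dim_eq_card_independent[OF ind] span
    by (metis DIM_real DIM_cart dim_UNIV dim_span mult.right_neutral top.extremum_uniqueI)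
  then show "inj v" by (intro eq_card_imp_inj_on) auto
qed

text \<open>The formula inside \<open>lagrangian_angle\<close>, detached from charts and forms so
  that the angle can be studied as a function of two matrices.\<close>

definition rel_angle :: "real^'n^'n \<Rightarrow> real^'n::finite^'n \<Rightarrow> real" where
  "rel_angle G S = (\<Sum>l\<in>rel_eigenvalues G S. real (dim (rel_eigenspace G S l)) * arctan l)"

lemma rel_angle_eigenbasis:
  assumes b: "rel_eigenbasis G S v l" and G: "pos_def_matrix G" and S: "transpose S = S"
  shows "rel_angle G S = (\<Sum>i\<in>UNIV. arctan (l i))"
proof -
  have Gs: "x \<bullet> (G *v y) = y \<bullet> (G *v x)" for x y
    using G symmetric_matrix_inner_commute by (auto simp: pos_def_matrix_def)
  have espace: "rel_eigenspace G S a = span (v ` {i. l i = a})" for a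
  proof
    show "span (v ` {i. l i = a}) \<subseteq> rel_eigenspace G S a"
    proof (rule span_minimal)
      show "v ` {i. l i = a} \<subseteq> rel_eigenspace G S a"
        using b by (auto simp: rel_eigenspace_def rel_eigenbasis_def)
      show "subspace (rel_eigenspace G S a)"
        by (auto simp: subspace_def rel_eigenspace_def matrix_vector_right_distrib
            scaleR_add_right matrix_vector_mult_scaleR)
    qed
    show "rel_eigenspace G S a \<subseteq> span (v ` {i. l i = a})"
    proof
      fix x assume "x \<in> rel_eigenspace G S a"
      then have x: "S *v x = a *\<^sub>R (G *v x)" by (simp add: rel_eigenspace_def)
      \<comment> \<open>Symmetry of \<open>S\<close> evaluates the pairing of \<open>S *v x\<close>
        with \<open>v i\<close> both as \<open>a\<close> times and as \<open>l i\<close> times the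
        same number; eigenvectors for different eigenvalues are \<open>G\<close>-orthogonal.\<close>
      have z: "v i \<bullet> (G *v x) = 0" if "l i \<noteq> a" for i
      proof -
        have "v i \<bullet> (S *v x) = l i * (v i \<bullet> (G *v x))"
          using b symmetric_matrix_inner_commute[OF S, of "v i" x] Gs[of "v i" x]
          by (simp add: rel_eigenbasis_def)
        with x that show ?thesis by simp
      qed
      have "(\<Sum>i\<in>UNIV. (v i \<bullet> (G *v x)) *\<^sub>R v i) \<in> span (v ` {i. l i = a})"
      proof (intro span_sum)
        fix i show "(v i \<bullet> (G *v x)) *\<^sub>R v i \<in> span (v ` {i. l i = a})"
          by (cases "l i = a") (auto simp: z span_zero intro: span_mul span_base)
      qed
      then show "x \<in> span (v ` {i. l i = a})" using rel_eigenbasis_expand[OF b, of x] by simp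
    qed
  qed
  have inj: "inj v" and ind: "independent (range v)" using rel_eigenbasis_independent[OF b] by auto
  have dim: "dim (rel_eigenspace G S a) = card {i. l i = a}" for a
  proof -
    have "independent (v ` {i. l i = a})" by (rule independent_mono[OF ind]) auto
    then have "dim (rel_eigenspace G S a) = card (v ` {i. l i = a})"
      by (simp add: espace dim_eq_card_independent)
    also have "\<dots> = card {i. l i = a}" using inj by (intro card_image) (auto simp: inj_def inj_on_def)
    finally show ?thesis .
  qed
  have eval: "rel_eigenvalues G S = range l"
  proof
    show "rel_eigenvalues G S \<subseteq> range l"
    proof
      fix a assume "a \<in> rel_eigenvalues G S"
      then have "rel_eigenspace G S a \<noteq> {0}" by (auto simp: rel_eigenvalues_def)
      then have "{i. l i = a} \<noteq> {}" unfolding espace by (metis image_empty span_empty)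
      then show "a \<in> range l" by auto
    qed
    show "range l \<subseteq> rel_eigenvalues G S"
    proof
      fix a assume "a \<in> range l"
      then obtain i where a: "a = l i" by blast
      have "v i \<noteq> 0" using b unfolding rel_eigenbasis_def
        by (metis inner_zero_left zero_neq_one)
      moreover have "v i \<in> rel_eigenspace G S a" using b
        by (simp add: a rel_eigenspace_def rel_eigenbasis_def)
      ultimately show "a \<in> rel_eigenvalues G S" by (auto simp: rel_eigenvalues_def)
    qed
  qed
  have "(\<Sum>i\<in>UNIV. arctan (l i)) = (\<Sum>a\<in>range l. \<Sum>i\<in>{i\<in>UNIV. l i = a}. arctan (l i))"
    by (rule sum.image_gen) simp
  also have "\<dots> = rel_angle G S"
    unfolding rel_angle_def eval by (rule sum.cong) (auto simp: dim)
  finally show ?thesis by simp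
qed

section \<open>The angle as an argument of a determinant\<close>

text \<open>The determinant of G + i S, the numerator in the exponential formula for the Lagrangian
  angle.\<close>

definition cdet :: "real^'n^'n \<Rightarrow> real^'n::finite^'n \<Rightarrow> complex" where
  "cdet G S = det (\<chi> i j. Complex (G $ i $ j) (S $ i $ j))"

text \<open>For invertible \<open>V\<close> the extra factor is a positive real, so a change of
  basis leaves the argument of the determinant alone.\<close>

lemma cdet_congruence:
  "of_real ((det V)\<^sup>2) * cdet G S = cdet (transpose V ** (G ** V)) (transpose V ** (S ** V))"
proof -
  let ?c = "\<lambda>V. (\<chi> i j. of_real (V $ i $ j)) :: complex^'n^'n"
  have dc: "det (?c V) = of_real (det V)" for V
    by (simp add: det_def)
  have "(\<chi> i j. Complex ((transpose V ** (G ** V)) $ i $ j) ((transpose V ** (S ** V)) $ i $ j))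
     = ?c (transpose V) ** ((\<chi> i j. Complex (G $ i $ j) (S $ i $ j)) ** ?c V)"
    by (simp add: vec_eq_iff matrix_matrix_mult_def complex_eq_iff)
  then show ?thesis
    unfolding cdet_def by (simp add: det_mul dc power2_eq_square)
qed

text \<open>In an eigenbasis \<open>G\<close> becomes the identity and \<open>S\<close> diagonal,
  while \<open>H\<close> stays arbitrary. The parameter \<open>t\<close> serves the path from the
  zero matrix to \<open>S\<close> that fixes the branch, \<open>s\<close> the variation in direction
  \<open>H\<close>.\<close>

lemma cdet_eigenbasis:
  assumes b: "rel_eigenbasis G S v l"
  shows "det (col_matrix v) \<noteq> 0"
    and "of_real ((det (col_matrix v))\<^sup>2) * cdet G (t *\<^sub>R S + s *\<^sub>R H) =
         det (\<chi> i j. (if i = j then Complex 1 (t * l i) else 0)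
                + of_real s * Complex 0 (v i \<bullet> (H *v v j)))"
proof -
  let ?V = "col_matrix v"
  show "det ?V \<noteq> 0"
    using rel_eigenbasis_congruence[OF b] by (metis det_I det_mul mult_zero_right zero_neq_one)
  have 1: "v i \<bullet> (G *v v j) = (if i = j then 1 else 0)" for i j
    using b by (simp add: rel_eigenbasis_def)
  then have 2: "v i \<bullet> (S *v v j) = (if i = j then l i else 0)" for i j
    using b by (simp add: rel_eigenbasis_def)
  have "(\<chi> i j. Complex ((transpose ?V ** (G ** ?V)) $ i $ j)
            ((transpose ?V ** ((t *\<^sub>R S + s *\<^sub>R H) ** ?V)) $ i $ j)) =
        (\<chi> i j. (if i = j then Complex 1 (t * l i) else 0) + of_real s * Complex 0 (v i \<bullet> (H *v v j)))"
    by (simp add: vec_eq_iff congruence_entry 1 2 matrix_vector_mult_add_rdistrib inner_add_right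
        scaleR_matrix_vector_assoc[symmetric] complex_eq_iff)
  then show "of_real ((det ?V)\<^sup>2) * cdet G (t *\<^sub>R S + s *\<^sub>R H) =
         det (\<chi> i j. (if i = j then Complex 1 (t * l i) else 0)
                + of_real s * Complex 0 (v i \<bullet> (H *v v j)))"
    unfolding cdet_congruence by (simp add: cdet_def)
qed

lemma cdet_eigenbasis_diagonal:
  assumes b: "rel_eigenbasis G S v l"
  shows "of_real ((det (col_matrix v))\<^sup>2) * cdet G (t *\<^sub>R S) = (\<Prod>i\<in>UNIV. Complex 1 (t * l i))"
proof -
  have "of_real ((det (col_matrix v))\<^sup>2) * cdet G (t *\<^sub>R S) =
      det (\<chi> i j. (if i = j then Complex 1 (t * l i) else 0))"
    using cdet_eigenbasis(2)[OF b, of t 0 0] by simp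
  also have "\<dots> = (\<Prod>i\<in>UNIV. Complex 1 (t * l i))"
    by (subst det_diagonal) auto
  finally show ?thesis .
qed

text \<open>Up to a nonzero real factor this is a product of numbers with real part 1. Nonvanishing
  is what allows a continuous logarithm.\<close>

lemma cdet_nonzero:
  assumes "pos_def_matrix G" "transpose S = S"
  shows "cdet G S \<noteq> 0"
proof -
  obtain v l where b: "rel_eigenbasis G S v l" using exists_rel_eigenbasis[OF assms] .
  have "(\<Prod>i\<in>UNIV. Complex 1 (1 * l i)) \<noteq> 0" by (simp add: Complex_eq_0)
  then show ?thesis using cdet_eigenbasis_diagonal[OF b, of 1] by auto
qed

lemma continuous_on_cdet: "continuous_on A (cdet G)"
  unfolding cdet_def det_def Complex_eq by (simp, intro continuous_intros)

text \<open>On complex numbers \<open>sgn z\<close> is \<open>z\<close> divided by its norm, so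
  working with \<open>sgn\<close> discards positive real factors and keeps the phase.\<close>

lemma sgn_complex_one_tan: "sgn (Complex 1 x) = exp (\<i> * of_real (arctan x))"
proof -
  have "norm (Complex 1 x) = sqrt (1 + x\<^sup>2)" by (simp add: cmod_def)
  then show ?thesis
    by (simp add: complex_eq_iff exp_eq_polar cos_arctan sin_arctan sgn_div_norm complex_sgn_def inverse_eq_divide)
qed

lemma sgn_exp_complex: "sgn (exp z) = exp (\<i> * of_real (Im z))"
proof -
  have "exp z = of_real (exp (Re z)) * exp (\<i> * of_real (Im z))"
    by (metis complex_eq exp_add exp_of_real)
  then show ?thesis by (simp add: sgn_mult sgn_of_real) (simp add: sgn_div_norm)
qed

lemma convex_symmetric_matrices: "convex {S :: real^'n^'n. transpose S = S}"
  by (auto simp: convex_def transpose_def vec_eq_iff)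

text \<open>The determinant fixes the angle only modulo \<open>2\<pi>\<close>. The symmetric matrices form a contractible
  set, so the determinant has a continuous logarithm there; following the path \<open>t \<mapsto> t S\<close> from the
  zero matrix shows that its imaginary part is the sum of arctangents up to a constant.\<close>

lemma rel_angle_logarithm:
  fixes G :: "real^'n^'n"
  assumes G: "pos_def_matrix G"
  shows "\<exists>L. continuous_on {S. transpose S = S} L \<and>
    (\<forall>S. transpose S = S \<longrightarrow> cdet G S = exp (L S) \<and> rel_angle G S = Im (L S) - Im (L 0))"
proof -
  obtain L where L: "continuous_on {S :: real^'n^'n. transpose S = S} L"
    and exp_L: "\<And>S. S \<in> {S. transpose S = S} \<Longrightarrow> cdet G S = exp (L S)"
    using continuous_logarithm_on_contractible[of "{S. transpose S = S}" "cdet G"]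
      continuous_on_cdet convex_imp_contractible[OF convex_symmetric_matrices] cdet_nonzero[OF G]
    by blast
  have "rel_angle G S = Im (L S) - Im (L 0)" if S: "transpose S = S" for S
  proof -
    obtain v l where b: "rel_eigenbasis G S v l" using exists_rel_eigenbasis[OF G S] .
    have sym: "transpose (t *\<^sub>R S) = t *\<^sub>R S" for t
      using S by (auto simp: transpose_def vec_eq_iff)
    \<comment> \<open>The discrepancy between the continuous argument and the arctangent branch
      along the path. Both describe the phase of the same determinant, so it lies in the multiples
      of 2 pi, and continuity then makes it constant. At \<open>t = 0\<close> all arctangents vanish
      and its value is \<open>Im (L 0)\<close>.\<close>
    define d where "d t = Im (L (t *\<^sub>R S)) - (\<Sum>i\<in>UNIV. arctan (t * l i))" for t
    have d2pi: "\<exists>n::int. d t = of_int n * (2 * pi)" for t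
    proof -
      define c where "c = (det (col_matrix v))\<^sup>2"
      have c: "c > 0" using cdet_eigenbasis(1)[OF b] by (simp add: c_def)
      have "sgn (of_real c * cdet G (t *\<^sub>R S)) = exp (\<i> * of_real (Im (L (t *\<^sub>R S))))"
        using c exp_L sym by (simp add: sgn_mult sgn_of_real sgn_exp_complex)
      moreover have "sgn (\<Prod>i\<in>I. Complex 1 (t * l i)) = exp (\<i> * of_real (\<Sum>i\<in>I. arctan (t * l i)))"
        if "finite I" for I
        using that by induction (simp_all add: sgn_mult sgn_complex_one_tan distrib_left exp_add)
      ultimately have "exp (\<i> * of_real (Im (L (t *\<^sub>R S)))) = exp (\<i> * of_real (\<Sum>i\<in>UNIV. arctan (t * l i)))"
        unfolding c_def cdet_eigenbasis_diagonal[OF b] by simp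
      then have "exp (\<i> * of_real (d t)) = 1"
        by (simp add: d_def right_diff_distrib exp_diff)
      then show ?thesis by (auto simp: exp_eq_1)
    qed
    have "d constant_on UNIV"
    proof (rule continuous_discrete_range_constant)
      have "continuous_on UNIV (L \<circ> (\<lambda>t. t *\<^sub>R S))"
        by (rule continuous_on_compose) (auto intro!: continuous_intros continuous_on_subset[OF L] sym)
      then show "continuous_on UNIV d"
        unfolding d_def by (auto intro!: continuous_intros simp: o_def)
      fix x :: real
      have "2 * pi \<le> norm (d y - d x)" if "d y \<noteq> d x" for y
      proof -
        obtain m n :: int where "d y = of_int m * (2 * pi)" "d x = of_int n * (2 * pi)"
          using d2pi by metis
        then have eq: "d y - d x = of_int (m - n) * (2 * pi)" by (simp add: algebra_simps)
        with that have "m \<noteq> n" by auto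
        then have "1 \<le> \<bar>m - n\<bar>" by linarith
        then have "1 \<le> \<bar>real_of_int (m - n)\<bar>" by linarith
        then show ?thesis unfolding eq using mult_right_mono[of 1 "\<bar>real_of_int (m - n)\<bar>" "2 * pi"]
          by (simp add: abs_mult)
      qed
      then show "\<exists>e>0. \<forall>y. y \<in> UNIV \<and> d y \<noteq> d x \<longrightarrow> e \<le> norm (d y - d x)"
        by (intro exI[of _ "2 * pi"]) auto
    qed simp
    then have "d 1 = d 0" by (metis constant_on_def UNIV_I)
    then show ?thesis
      by (simp add: d_def rel_angle_eigenbasis[OF b G S])
  qed
  with L exp_L show ?thesis by (intro exI[of _ L]) simp
qed

section \<open>First variation of the angle\<close>

text \<open>Only the identity permutation contributes: any other one moves at least two indices, and
  after one factor of its product is differentiated an off-diagonal factor, zero at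
  \<open>s = 0\<close>, remains.\<close>

lemma det_diagonal_perturbation_derivative:
  fixes d :: "'n::finite \<Rightarrow> 'a::real_normed_field"
  shows "((\<lambda>s. det (\<chi> i j. (if i = j then d i else 0) + s * N i j)) has_field_derivative
           (\<Sum>i\<in>UNIV. N i i * (\<Prod>j\<in>UNIV - {i}. d j))) (at 0)"
proof -
  \<comment> \<open>The derivative at 0 of the product belonging to the permutation
    \<open>p\<close>; the summand with \<open>0 * N j (p j)\<close> keeps the shape that the product
    rule yields.\<close>
  define T where "T p = (\<Sum>i\<in>UNIV. N i (p i) * (\<Prod>j\<in>UNIV - {i}. (if j = p j then d j else 0) + 0 * N j (p j)))"
    for p :: "'n \<Rightarrow> 'n"
  have T0: "T p = 0" if p: "p permutes UNIV" "p \<noteq> id" for p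
  proof -
    obtain a where a: "p a \<noteq> a" using p(2) by (auto simp: fun_eq_iff)
    have "\<exists>j\<in>UNIV - {i}. j \<noteq> p j" for i
    proof (cases "a = i")
      case True
      \<comment> \<open>If the differentiated factor sits at the moved index itself, its image is a
        second moved index.\<close>
      have "p (p i) \<noteq> p i" using permutes_inj[OF p(1)] a True by (auto simp: inj_def)
      then show ?thesis using a True by (intro bexI[of _ "p i"]) auto
    qed (use a in \<open>auto intro!: bexI[of _ a]\<close>)
    then have "(\<Prod>j\<in>UNIV - {i}. (if j = p j then d j else 0) + 0 * N j (p j)) = 0" for i
      by (intro prod_zero) (auto simp del: split_paired_Ex)
    then show ?thesis unfolding T_def by (simp only: mult_zero_right sum.neutral_const)
  qed
  have "((\<lambda>s. det (\<chi> i j. (if i = j then d i else 0) + s * N i j)) has_field_derivative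
           (\<Sum>p\<in>{p. p permutes UNIV}. of_int (sign p) * T p)) (at 0)"
    unfolding det_def T_def vec_lambda_beta
    by (intro DERIV_sum DERIV_cmult has_field_derivative_prod) (auto intro!: derivative_eq_intros)
  also have "(\<Sum>p\<in>{p. p permutes UNIV}. of_int (sign p) * T p) = (\<Sum>p\<in>{id}. of_int (sign p) * T p)"
    by (rule sum.mono_neutral_right) (auto simp: T0 permutes_id)
  also have "\<dots> = (\<Sum>i\<in>UNIV. N i i * (\<Prod>j\<in>UNIV - {i}. d j))"
    by (simp add: T_def)
  finally show ?thesis .
qed

text \<open>The logarithmic derivative of the determinant is the sum of i k_j / (1 + i l_j) with k_j
  = H(v_j, v_j), whose imaginary part is the claimed sum. The eigenbasis is only that of
  \<open>S\<close> itself; nothing is asserted about eigenvectors of nearby matrices.\<close>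

lemma rel_angle_has_derivative_at_0:
  fixes G S H :: "real^'n^'n"
  assumes G: "pos_def_matrix G" and S: "transpose S = S" and H: "transpose H = H"
    and b: "rel_eigenbasis G S v l"
  shows "((\<lambda>s. rel_angle G (S + s *\<^sub>R H)) has_real_derivative
           (\<Sum>i\<in>UNIV. (v i \<bullet> (H *v v i)) / (1 + (l i)\<^sup>2))) (at 0)"
proof -
  from rel_angle_logarithm[OF G] obtain L
    where *: "continuous_on {S. transpose S = S} L \<and>
      (\<forall>S. transpose S = S \<longrightarrow> cdet G S = exp (L S) \<and> rel_angle G S = Im (L S) - Im (L 0))" ..
  then have L: "continuous_on {S. transpose S = S} L" by simp
  from * have exp_L: "cdet G S = exp (L S)" and angle: "rel_angle G S = Im (L S) - Im (L 0)"
    if "transpose S = S" for S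
    using that by simp_all
  have sym: "transpose (S + s *\<^sub>R H) = S + s *\<^sub>R H" for s
    using S H by (auto simp: transpose_def vec_eq_iff)
  define c where "c = complex_of_real ((det (col_matrix v))\<^sup>2)"
  have c: "c \<noteq> 0" using cdet_eigenbasis(1)[OF b] by (simp add: c_def)
  define d where "d i = Complex 1 (l i)" for i
  have d: "d i \<noteq> 0" for i by (simp add: d_def Complex_eq_0)
  define k where "k i = v i \<bullet> (H *v v i)" for i
  define E where "E s = det (\<chi> i j. (if i = j then d i else 0) + s * Complex 0 (v i \<bullet> (H *v v j)))" for s
  have E: "c * cdet G (S + s *\<^sub>R H) = E (of_real s)" for s
    unfolding c_def E_def d_def
    using cdet_eigenbasis(2)[OF b, of 1 s H] by (simp only: scaleR_one mult_1)
  have E0: "E 0 = (\<Prod>i\<in>UNIV. d i)"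
    unfolding E_def by (subst det_diagonal) auto
  then have E0nz: "E 0 \<noteq> 0" using d by simp
  define E' where "E' = (\<Sum>i\<in>UNIV. Complex 0 (k i) * (\<Prod>j\<in>UNIV - {i}. d j))"
  have dE: "(E has_field_derivative E') (at 0)"
    unfolding E_def E'_def k_def by (rule det_diagonal_perturbation_derivative)
  have "E' / E 0 = (\<Sum>i\<in>UNIV. Complex 0 (k i) / d i)"
    unfolding E'_def sum_divide_distrib
  proof (rule sum.cong)
    fix i
    have "E 0 = d i * (\<Prod>j\<in>UNIV - {i}. d j)" unfolding E0 by (rule prod.remove) auto
    then show "Complex 0 (k i) * (\<Prod>j\<in>UNIV - {i}. d j) / E 0 = Complex 0 (k i) / d i"
      using E0nz d by (simp add: field_simps)
  qed simp
  then have ImE: "Im (E' / E 0) = (\<Sum>i\<in>UNIV. k i / (1 + (l i)\<^sup>2))"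
    by (simp add: d_def Im_divide)
  \<comment> \<open>The increment of the continuous logarithm. Where its modulus is below 1 its
    imaginary part lies between -pi and pi, so it coincides with the principal logarithm of the
    quotient of determinants, which can be differentiated explicitly.\<close>
  define m where "m s = L (S + s *\<^sub>R H) - L S" for s
  have "continuous_on UNIV (L \<circ> (\<lambda>s. S + s *\<^sub>R H))"
    by (rule continuous_on_compose) (auto intro!: continuous_intros continuous_on_subset[OF L] sym)
  then have "continuous_on UNIV m" unfolding m_def by (auto intro!: continuous_intros simp: o_def)
  then have "open (m -` ball 0 1)"
    by (metis continuous_on_open_vimage open_UNIV open_ball vimage_UNIV Int_UNIV_right)
  moreover have "0 \<in> m -` ball 0 1" by (simp add: m_def)
  ultimately have op: "open (m -` ball 0 1)" "0 \<in> m -` ball 0 1" by auto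
  have Ln: "Im (Ln (E (of_real s) / E 0)) + rel_angle G S = rel_angle G (S + s *\<^sub>R H)"
    if "s \<in> m -` ball 0 1" for s
  proof -
    have "cmod (m s) < 1" using that by simp
    then have "\<bar>Im (m s)\<bar> < 1" using abs_Im_le_cmod[of "m s"] by linarith
    then have "Ln (exp (m s)) = m s" using pi_gt3 by (intro Ln_exp) auto
    moreover have "exp (m s) = E (of_real s) / E 0"
    proof -
      have "E (of_real s) / E 0 = cdet G (S + s *\<^sub>R H) / cdet G S"
        using E[of s] E[of 0] c by (metis mult_divide_mult_cancel_left of_real_0 scaleR_zero_left add_0_right)
      then show ?thesis by (simp add: m_def exp_L sym S exp_diff)
    qed
    ultimately show ?thesis by (simp add: m_def angle sym S)
  qed
  have "((\<lambda>z. E z / E 0) has_field_derivative E' / E 0) (at 0)"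
    by (intro DERIV_cdivide dE)
  \<comment> \<open>The inner function has value 1 at 0, away from the branch cut of
    \<open>Ln\<close>.\<close>
  then have "((\<lambda>z. Ln (E z / E 0)) has_field_derivative inverse 1 * (E' / E 0)) (at 0)"
    using E0nz by (intro DERIV_chain2[of Ln "inverse 1"]) (use has_field_derivative_Ln[of 1] in auto)
  then have "((\<lambda>z. Ln (E z / E 0)) has_field_derivative E' / E 0) (at (of_real 0))"
    by simp
  then have "((\<lambda>s. Ln (E (of_real s) / E 0)) has_vector_derivative E' / E 0) (at (0::real))"
    by (rule has_vector_derivative_real_field)
  then have "((\<lambda>s. Im (Ln (E (of_real s) / E 0))) has_vector_derivative Im (E' / E 0)) (at (0::real))"
    by (rule bounded_linear.has_vector_derivative[OF bounded_linear_Im])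
  then have "((\<lambda>s. Im (Ln (E (of_real s) / E 0))) has_real_derivative Im (E' / E 0)) (at 0)"
    by (simp only: has_real_derivative_iff_has_vector_derivative)
  then have "((\<lambda>s. Im (Ln (E (of_real s) / E 0)) + rel_angle G S) has_real_derivative
      Im (E' / E 0) + 0) (at 0)"
    by (intro DERIV_add DERIV_const)
  then have "((\<lambda>s. rel_angle G (S + s *\<^sub>R H)) has_real_derivative Im (E' / E 0) + 0) (at 0)"
    by (rule has_field_derivative_transform_within_open[OF _ op Ln])
  then show ?thesis by (simp add: ImE k_def)
qed

text \<open>The derivative formula accepts any eigenbasis, so one is chosen for each
  \<open>s\<close> separately, with no regularity in \<open>s\<close>; the derivative at
  \<open>s\<close> is the derivative at 0 for the base point
  \<open>S + s *\<^sub>R H\<close>.\<close>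

lemma rel_angle_mean_value:
  fixes G S H :: "real^'n^'n"
  assumes G: "pos_def_matrix G" and S: "transpose S = S" and H: "transpose H = H"
  obtains s v l where "0 < s" "s < 1" "rel_eigenbasis G (S + s *\<^sub>R H) v l"
    "rel_angle G (S + H) - rel_angle G S = (\<Sum>i\<in>UNIV. (v i \<bullet> (H *v v i)) / (1 + (l i)\<^sup>2))"
proof -
  have "\<forall>s. \<exists>p. rel_eigenbasis G (S + s *\<^sub>R H) (fst p) (snd p)"
  proof
    fix s
    have "transpose (S + s *\<^sub>R H) = S + s *\<^sub>R H"
      using S H by (auto simp: transpose_def vec_eq_iff)
    then show "\<exists>p. rel_eigenbasis G (S + s *\<^sub>R H) (fst p) (snd p)"
      using exists_rel_eigenbasis[OF G] by (metis fst_conv snd_conv)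
  qed
  from choice[OF this] obtain p
    where p: "\<forall>s. rel_eigenbasis G (S + s *\<^sub>R H) (fst (p s)) (snd (p s))" ..
  define D where "D s = (\<Sum>i\<in>UNIV. (fst (p s) i \<bullet> (H *v fst (p s) i)) / (1 + (snd (p s) i)\<^sup>2))" for s
  have deriv: "((\<lambda>s. rel_angle G (S + s *\<^sub>R H)) has_real_derivative D s) (at s)" for s
  proof -
    have "transpose (S + s *\<^sub>R H) = S + s *\<^sub>R H"
      using S H by (auto simp: transpose_def vec_eq_iff)
    from rel_angle_has_derivative_at_0[OF G this H p[rule_format]]
    \<comment> \<open>The point 0 is written as \<open>s + - s\<close> so that
      \<open>DERIV_shift\<close> can translate it to \<open>s\<close>.\<close>
    have "((\<lambda>t. rel_angle G (S + s *\<^sub>R H + t *\<^sub>R H)) has_real_derivative D s) (at (s + - s))"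
      by (simp add: D_def)
    then have "((\<lambda>t. rel_angle G (S + s *\<^sub>R H + (t + - s) *\<^sub>R H)) has_real_derivative D s) (at s)"
      by (simp only: DERIV_shift)
    then show ?thesis by (simp add: algebra_simps)
  qed
  obtain s where "0 < s" "s < 1"
    "rel_angle G (S + 1 *\<^sub>R H) - rel_angle G (S + 0 *\<^sub>R H) = (1 - 0) * D s"
    using MVT2[of 0 1 "\<lambda>s. rel_angle G (S + s *\<^sub>R H)" D] deriv by auto
  then show ?thesis using p by (intro that[of s "fst (p s)" "snd (p s)"]) (auto simp: D_def)
qed

section \<open>Uniform bounds on the frame of eigenvectors\<close>

text \<open>With coefficients c_i in the eigenbasis, the squared Euclidean norm of
  \<open>\<xi>\<close> is the sum of c_i times the product of \<open>v i\<close> with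
  \<open>\<xi>\<close>, and G(\<xi>, \<xi>) is the sum of the c_i^2; Cauchy-Schwarz links the two.
  This is the lower ellipticity bound in Euclidean terms.\<close>

lemma rel_eigenbasis_frame_bound:
  fixes v :: "'n::finite \<Rightarrow> real^'n"
  assumes b: "rel_eigenbasis G S v l" and Gs: "transpose G = G" and \<Gamma>: "\<Gamma> > 0"
    and G: "\<And>x. x \<bullet> (G *v x) \<le> \<Gamma> * (norm x)\<^sup>2"
  shows "(norm \<xi>)\<^sup>2 \<le> \<Gamma> * (\<Sum>i\<in>UNIV. (v i \<bullet> \<xi>)\<^sup>2)"
proof -
  define c where "c i = v i \<bullet> (G *v \<xi>)" for i
  have exp: "\<xi> = (\<Sum>i\<in>UNIV. c i *\<^sub>R v i)"
    unfolding c_def by (rule rel_eigenbasis_expand[OF b])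
  have 1: "(norm \<xi>)\<^sup>2 = (\<Sum>i\<in>UNIV. c i * (v i \<bullet> \<xi>))"
  proof -
    have "\<xi> \<bullet> \<xi> = (\<Sum>i\<in>UNIV. c i *\<^sub>R v i) \<bullet> \<xi>" using exp by simp
    then show ?thesis by (simp add: power2_norm_eq_inner inner_sum_left)
  qed
  have 2: "\<xi> \<bullet> (G *v \<xi>) = (\<Sum>i\<in>UNIV. (c i)\<^sup>2)"
  proof -
    have "\<xi> \<bullet> (G *v \<xi>) = (\<Sum>i\<in>UNIV. c i *\<^sub>R v i) \<bullet> (G *v \<xi>)" using exp by simp
    then show ?thesis by (simp add: inner_sum_left c_def power2_eq_square)
  qed
  have "((norm \<xi>)\<^sup>2)\<^sup>2 \<le> (\<Sum>i\<in>UNIV. (c i)\<^sup>2) * (\<Sum>i\<in>UNIV. (v i \<bullet> \<xi>)\<^sup>2)"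
    unfolding 1 by (rule Cauchy_Schwarz_ineq_sum)
  also have "\<dots> \<le> (\<Gamma> * (norm \<xi>)\<^sup>2) * (\<Sum>i\<in>UNIV. (v i \<bullet> \<xi>)\<^sup>2)"
    using G[of \<xi>] unfolding 2 by (intro mult_right_mono sum_nonneg) auto
  finally have *: "(norm \<xi>)\<^sup>2 * (norm \<xi>)\<^sup>2 \<le> (norm \<xi>)\<^sup>2 * (\<Gamma> * (\<Sum>i\<in>UNIV. (v i \<bullet> \<xi>)\<^sup>2))"
    by (simp add: power2_eq_square mult_ac)
  show ?thesis
  proof (cases "\<xi> = 0")
    case False
    then have "(norm \<xi>)\<^sup>2 > 0" by simp
    with * show ?thesis using mult_le_cancel_left_pos by blast
  qed simp
qed

text \<open>The normalization of \<open>v i\<close> bounds its Euclidean length, and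
  \<open>l i\<close> is the value of \<open>S\<close> on the normalized vector.\<close>

lemma rel_eigenbasis_norm_bounds:
  assumes b: "rel_eigenbasis G S v l" and g: "g > 0"
    and G: "\<And>x. g * (norm x)\<^sup>2 \<le> x \<bullet> (G *v x)"
    and S: "\<And>x. \<bar>x \<bullet> (S *v x)\<bar> \<le> C * (norm x)\<^sup>2" and C: "C \<ge> 0"
  shows "(norm (v i))\<^sup>2 \<le> 1 / g" "\<bar>l i\<bar> \<le> C / g"
proof -
  have *: "v i \<bullet> (G *v v i) = 1" using b by (simp add: rel_eigenbasis_def)
  then show n: "(norm (v i))\<^sup>2 \<le> 1 / g" using G[of "v i"] g by (simp add: field_simps)
  have "l i = v i \<bullet> (S *v v i)" using b * by (simp add: rel_eigenbasis_def)
  then have "\<bar>l i\<bar> \<le> C * (norm (v i))\<^sup>2" using S[of "v i"] by simp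
  also have "\<dots> \<le> C * (1 / g)" using n C by (rule mult_left_mono)
  finally show "\<bar>l i\<bar> \<le> C / g" by simp
qed

lemma rel_angle_mono_neg:
  fixes G S H :: "real^'n^'n"
  assumes "pos_def_matrix G" "transpose S = S" "transpose H = H"
    and H: "\<And>x. x \<bullet> (H *v x) \<le> 0"
  shows "rel_angle G (S + H) \<le> rel_angle G S"
proof -
  obtain s v l where "0 < s" "s < 1" "rel_eigenbasis G (S + s *\<^sub>R H) v l" and
    "rel_angle G (S + H) - rel_angle G S = (\<Sum>i\<in>UNIV. (v i \<bullet> (H *v v i)) / (1 + (l i)\<^sup>2))"
    by (rule rel_angle_mean_value[OF assms(1-3)])
  note this(4)
  also have "\<dots> \<le> 0"
    by (intro sum_nonpos divide_nonpos_pos H) (auto simp: add_pos_nonneg)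
  finally show ?thesis by simp
qed

text \<open>Equality of the angles makes the mean value formula a linear relation on
  \<open>H\<close>. Bounds on \<open>S\<close> at both ends of the segment pass to the unknown
  intermediate tensor by convexity, so the constants depend on \<open>g\<close>,
  \<open>\<Gamma>\<close> and \<open>C\<close> alone.\<close>

lemma rel_angle_eq_elliptic:
  fixes G S H :: "real^'n^'n"
  assumes pd: "pos_def_matrix G" and S: "transpose S = S" and H: "transpose H = H"
    and pos: "g > 0" "\<Gamma> > 0" "C \<ge> 0"
    and Gl: "\<And>x. g * (norm x)\<^sup>2 \<le> x \<bullet> (G *v x)"
    and Gu: "\<And>x. x \<bullet> (G *v x) \<le> \<Gamma> * (norm x)\<^sup>2"
    and S0: "\<And>x. \<bar>x \<bullet> (S *v x)\<bar> \<le> C * (norm x)\<^sup>2"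
    and S1: "\<And>x. \<bar>x \<bullet> ((S + H) *v x)\<bar> \<le> C * (norm x)\<^sup>2"
    and eq: "rel_angle G (S + H) = rel_angle G S"
  shows "\<exists>u :: 'n \<Rightarrow> real^'n. (\<forall>i. norm (u i) \<le> sqrt (1 / g)) \<and>
     (\<forall>\<xi>. 1 / (\<Gamma> * (1 + (C / g)\<^sup>2)) * (norm \<xi>)\<^sup>2 \<le> (\<Sum>i\<in>UNIV. (u i \<bullet> \<xi>)\<^sup>2)) \<and>
     (\<Sum>i\<in>UNIV. u i \<bullet> (H *v u i)) = 0"
proof -
  obtain s v l where s: "0 < s" "s < 1" and b: "rel_eigenbasis G (S + s *\<^sub>R H) v l"
    and diff: "rel_angle G (S + H) - rel_angle G S = (\<Sum>i\<in>UNIV. (v i \<bullet> (H *v v i)) / (1 + (l i)\<^sup>2))"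
    by (rule rel_angle_mean_value[OF pd S H])
  \<comment> \<open>Rescaling absorbs the weights 1 / (1 + (l i)^2) into the vectors; the eigenvalue
    bound \<open>C / g\<close> keeps the rescaled frame uniformly spanning.\<close>
  define u where "u i = (1 / sqrt (1 + (l i)\<^sup>2)) *\<^sub>R v i" for i
  have Ss: "\<bar>x \<bullet> ((S + s *\<^sub>R H) *v x)\<bar> \<le> C * (norm x)\<^sup>2" for x
  proof -
    have "x \<bullet> ((S + s *\<^sub>R H) *v x) = (1 - s) * (x \<bullet> (S *v x)) + s * (x \<bullet> ((S + H) *v x))"
      by (simp add: matrix_vector_mult_add_rdistrib inner_add_right scaleR_matrix_vector_assoc[symmetric] algebra_simps)
    also have "\<bar>\<dots>\<bar> \<le> (1 - s) * \<bar>x \<bullet> (S *v x)\<bar> + s * \<bar>x \<bullet> ((S + H) *v x)\<bar>"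
      using s by (simp add: abs_mult abs_triangle_ineq[THEN order_trans])
    also have "\<dots> \<le> (1 - s) * (C * (norm x)\<^sup>2) + s * (C * (norm x)\<^sup>2)"
      using s S0 S1 by (intro add_mono mult_left_mono) auto
    finally show ?thesis by (simp add: algebra_simps)
  qed
  have vn: "(norm (v i))\<^sup>2 \<le> 1 / g" and ln: "\<bar>l i\<bar> \<le> C / g" for i
    using rel_eigenbasis_norm_bounds[OF b pos(1) Gl Ss pos(3)] by auto
  have "norm (u i) \<le> sqrt (1 / g)" for i
  proof -
    have "norm (u i) = norm (v i) / sqrt (1 + (l i)\<^sup>2)" by (simp add: u_def)
    also have "\<dots> \<le> norm (v i) / 1" 
      by (intro divide_left_mono) (auto simp: add_pos_nonneg)
    also have "\<dots> = norm (v i)" by simp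
    also have "\<dots> \<le> sqrt (1 / g)" using vn[of i] by (simp add: real_le_rsqrt)
    finally show ?thesis .
  qed
  moreover have "1 / (\<Gamma> * (1 + (C / g)\<^sup>2)) * (norm \<xi>)\<^sup>2 \<le> (\<Sum>i\<in>UNIV. (u i \<bullet> \<xi>)\<^sup>2)" for \<xi>
  proof -
    have k: "1 + (C / g)\<^sup>2 > 0" by (simp add: add_pos_nonneg)
    have "1 / (\<Gamma> * (1 + (C / g)\<^sup>2)) * (norm \<xi>)\<^sup>2 \<le>
        1 / (\<Gamma> * (1 + (C / g)\<^sup>2)) * (\<Gamma> * (\<Sum>i\<in>UNIV. (v i \<bullet> \<xi>)\<^sup>2))"
      using rel_eigenbasis_frame_bound[OF b _ pos(2) Gu] pd pos k
      by (intro mult_left_mono) (auto simp: pos_def_matrix_def)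
    also have "\<dots> = (\<Sum>i\<in>UNIV. (v i \<bullet> \<xi>)\<^sup>2 / (1 + (C / g)\<^sup>2))"
      using pos by (simp add: sum_divide_distrib)
    also have "\<dots> \<le> (\<Sum>i\<in>UNIV. (u i \<bullet> \<xi>)\<^sup>2)"
    proof (rule sum_mono)
      fix i
      have "(v i \<bullet> \<xi>)\<^sup>2 / (1 + (C / g)\<^sup>2) \<le> (v i \<bullet> \<xi>)\<^sup>2 / (1 + (l i)\<^sup>2)"
      proof (rule divide_left_mono)
        have "\<bar>l i\<bar>\<^sup>2 \<le> (C / g)\<^sup>2" using ln[of i] by (intro power_mono) auto
        then show "1 + (l i)\<^sup>2 \<le> 1 + (C / g)\<^sup>2" by simp
        show "0 < (1 + (C / g)\<^sup>2) * (1 + (l i)\<^sup>2)" 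
          using k by (intro mult_pos_pos) (auto simp: add_pos_nonneg)
      qed simp
      also have "\<dots> = (u i \<bullet> \<xi>)\<^sup>2"
        by (simp add: u_def power_mult_distrib power_divide)
      finally show "(v i \<bullet> \<xi>)\<^sup>2 / (1 + (C / g)\<^sup>2) \<le> (u i \<bullet> \<xi>)\<^sup>2" .
    qed
    finally show ?thesis .
  qed
  moreover have "(\<Sum>i\<in>UNIV. u i \<bullet> (H *v u i)) = 0"
  proof -
    have "u i \<bullet> (H *v u i) = (v i \<bullet> (H *v v i)) / (1 + (l i)\<^sup>2)" for i
      by (simp add: u_def matrix_vector_mult_scaleR)
    then show ?thesis using diff eq by simp
  qed
  ultimately show ?thesis by blast
qed

section \<open>The strong maximum principle\<close>

text \<open>A positive \<open>D\<close> would make \<open>\<phi>'\<close> positive immediately to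
  the right of 0, and by the mean value theorem \<open>\<phi>\<close> would exceed its maximum
  there.\<close>

lemma local_max_second_derivative_nonpos:
  fixes \<phi> \<phi>' :: "real \<Rightarrow> real"
  assumes d1: "\<And>t. \<bar>t\<bar> < \<delta> \<Longrightarrow> (\<phi> has_real_derivative \<phi>' t) (at t)" and \<delta>: "\<delta> > 0"
    and d2: "(\<phi>' has_real_derivative D) (at 0)"
    and max: "\<And>t. \<bar>t\<bar> < \<delta> \<Longrightarrow> \<phi> t \<le> \<phi> 0"
  shows "\<phi>' 0 = 0" "D \<le> 0"
proof -
  show d0: "\<phi>' 0 = 0"
    using DERIV_local_max[OF d1[of 0] \<delta>] max \<delta> by auto
  show "D \<le> 0"
  proof (rule ccontr)
    assume "\<not> D \<le> 0"
    then obtain e where e: "e > 0" "\<And>h. 0 < h \<Longrightarrow> h < e \<Longrightarrow> \<phi>' 0 < \<phi>' (0 + h)"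
      using DERIV_pos_inc_right[OF d2] by auto
    define t where "t = min e \<delta> / 2"
    have t: "0 < t" "t < e" "t < \<delta>" using e \<delta> by (auto simp: t_def)
    obtain z where z: "0 < z" "z < t" "\<phi> t - \<phi> 0 = (t - 0) * \<phi>' z"
      using MVT2[of 0 t \<phi> \<phi>'] t d1 by auto
    have "\<phi>' z > 0" using e(2)[of z] z t d0 by auto
    then have "0 < t * \<phi>' z" using t by simp
    then have "\<phi> t > \<phi> 0" using z by simp
    then show False using max[of t] t by auto
  qed
qed

text \<open>Factor the difference of squares: one factor is at most \<open>r\<close>, the other at
  most 3 times the radius because \<open>r\<close> does not exceed it.\<close>

lemma nearby_on_sphere:
  fixes z c x :: "'a::real_inner"
  assumes r: "norm (x - z) \<le> r" "r \<le> norm (z - c)"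
  shows "\<bar>(norm (x - c))\<^sup>2 - (norm (z - c))\<^sup>2\<bar> \<le> 3 * norm (z - c) * r"
proof -
  let ?R = "norm (z - c)"
  have d: "\<bar>norm (x - c) - ?R\<bar> \<le> r"
    using norm_triangle_ineq3[of "x - c" "z - c"] r by simp
  have s: "norm (x - c) + ?R \<le> 3 * ?R" "norm (x - c) + ?R \<ge> 0" using d r by auto
  have "\<bar>(norm (x - c))\<^sup>2 - ?R\<^sup>2\<bar> = (norm (x - c) + ?R) * \<bar>norm (x - c) - ?R\<bar>"
    by (simp add: power2_eq_square square_diff_square_factored abs_mult)
  also have "\<dots> \<le> (3 * ?R) * r"
    using d s by (intro mult_mono) auto
  finally show ?thesis .
qed

text \<open>The barrier \<open>b\<close> is a quadratic function of the squared distance to \<open>c\<close> that is small but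
  strictly convex near the sphere through \<open>z\<close>.\<close>

lemma hopf_barrier_contradiction:
  fixes F :: "'a::euclidean_space \<Rightarrow> real" and F'' :: "'a \<Rightarrow> 'a \<Rightarrow> 'a \<Rightarrow> real"
  assumes S: "open S"
    and dF: "\<And>x. x \<in> S \<Longrightarrow> (F has_derivative F' x) (at x)"
    and d2F: "\<And>x v. x \<in> S \<Longrightarrow> ((\<lambda>y. F' y v) has_derivative F'' x v) (at x)"
    and B: "\<And>x v. x \<in> S \<Longrightarrow> norm (B x v) \<le> K * (norm v)\<^sup>2" and K: "K \<ge> 0"
    and m: "m > 0" and C: "C \<ge> 0"
    and ell: "\<And>x. x \<in> S \<Longrightarrow> \<exists>u :: 'i::finite \<Rightarrow> 'a. (\<forall>i. norm (u i) \<le> C) \<and>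
       (\<forall>\<xi>. m * (norm \<xi>)\<^sup>2 \<le> (\<Sum>i\<in>UNIV. (u i \<bullet> \<xi>)\<^sup>2)) \<and>
       0 \<le> (\<Sum>i\<in>UNIV. F'' x (u i) (u i) - F' x (B x (u i)))"
    and le: "\<And>x. x \<in> S \<Longrightarrow> F x \<le> M" and z: "z \<in> S" "F z = M" and c: "c \<noteq> z"
    and less: "\<And>x. x \<in> S \<Longrightarrow> norm (x - c) \<le> norm (z - c) \<Longrightarrow> x \<noteq> z \<Longrightarrow> F x < M"
  shows False
proof -
  define R where "R = norm (z - c)"
  have R: "R > 0" using c by (simp add: R_def)
  \<comment> \<open>\<open>Q\<close> collects the error terms of the final estimate: 12 is 4 from
    the derivatives of the barrier times 3 from \<open>k \<le> 3 * \<delta>\<close>, and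
    \<open>1 + 2 * R * K\<close> allows for the first-order term. \<open>\<delta>\<close> is then
    chosen so that the error stays below the good term \<open>2 * m * R\<^sup>2\<close>; the
    \<open>+ 1\<close> covers \<open>Q = 0\<close>.\<close>
  define Q where "Q = 12 * real CARD('i) * C\<^sup>2 * (1 + 2 * R * K)"
  have Q: "Q \<ge> 0" using C K R by (simp add: Q_def)
  define \<delta> where "\<delta> = m * R\<^sup>2 / (Q + 1)"
  have \<delta>: "\<delta> > 0" using m R Q by (simp add: \<delta>_def)
  have \<delta>Q: "\<delta> * Q < 2 * m * R\<^sup>2"
  proof -
    have "\<delta> * Q \<le> \<delta> * (Q + 1)" using \<delta> by simp
    also have "\<dots> = m * R\<^sup>2" using Q by (simp add: \<delta>_def)
    also have "\<dots> < 2 * m * R\<^sup>2" using m R by simp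
    finally show ?thesis .
  qed
  obtain r0 where r0: "r0 > 0" "cball z r0 \<subseteq> S" using S z(1) open_contains_cball by blast
  \<comment> \<open>The three bounds keep the small ball inside \<open>S\<close>, keep the distance
    to \<open>c\<close> comparable with \<open>R\<close>, and keep the squared distance within
    \<open>\<delta>\<close> of \<open>R\<^sup>2\<close>.\<close>
  define r where "r = min r0 (min (R / 2) (\<delta> / (3 * R)))"
  have r: "r > 0" "r \<le> r0" "r \<le> R / 2" "3 * R * r \<le> \<delta>"
  proof -
    have "r \<le> \<delta> / (3 * R)" by (simp add: r_def)
    then show "3 * R * r \<le> \<delta>" using R by (simp add: field_simps)
  qed (use r0 R \<delta> in \<open>auto simp: r_def\<close>)
  have sub: "cball z r \<subseteq> S" using r0 r by (meson order_trans subset_cball)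
  define s where "s x = (norm (x - c))\<^sup>2" for x
  have s: "\<bar>s x - R\<^sup>2\<bar> \<le> \<delta>" if "x \<in> cball z r" for x
    using nearby_on_sphere[of x z r c] that r R unfolding s_def R_def
    by (auto simp: dist_norm norm_minus_commute)
  \<comment> \<open>This offset puts \<open>\<kappa> - s x\<close> between \<open>\<delta>\<close>
    and \<open>3 * \<delta>\<close>. There the barrier decreases with the distance to
    \<open>c\<close>, and outside the ball about \<open>c\<close> it is at most its value at
    \<open>z\<close>.\<close>
  define \<kappa> where "\<kappa> = R\<^sup>2 + 2 * \<delta>"
  define b where "b x = (\<kappa> - s x)\<^sup>2" for x
  have q: "\<delta> \<le> \<kappa> - s x" "\<kappa> - s x \<le> 3 * \<delta>" if "x \<in> cball z r" for x
    using s[OF that] by (auto simp: \<kappa>_def abs_le_iff)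
  have contF: "continuous_on S F"
    using dF has_derivative_continuous by (intro continuous_at_imp_continuous_on) blast
  have contb: "continuous_on A b" for A
    unfolding b_def s_def by (intro continuous_intros)
  have bz: "b z = (2 * \<delta>)\<^sup>2" by (simp add: b_def s_def \<kappa>_def R_def)
  \<comment> \<open>The part of the small sphere where the barrier may exceed its value at
    \<open>z\<close>. Here \<open>F\<close> stays below \<open>M\<close>, by compactness with a gap
    \<open>M - F1\<close>, which pays for a small multiple of the barrier.\<close>
  define P where "P = sphere z r \<inter> cball c R"
  have Pc: "compact P" by (simp add: P_def compact_Int_closed)
  have PS: "P \<subseteq> S" using sub by (auto simp: P_def)
  have "\<exists>F1<M. \<forall>x\<in>P. F x \<le> F1"
  proof (cases "P = {}")
    case True then show ?thesis by (intro exI[of _ "M - 1"]) auto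
  next
    case False
    obtain p where p: "p \<in> P" "\<And>x. x \<in> P \<Longrightarrow> F x \<le> F p"
      using continuous_attains_sup[OF Pc False continuous_on_subset[OF contF PS]] by blast
    have "p \<in> S" using p(1) PS by blast
    then have "F p < M" using p(1) r(1) less[of p]
      by (auto simp: P_def R_def dist_norm norm_minus_commute)
    then show ?thesis using p by blast
  qed
  then obtain F1 where F1: "F1 < M" "\<And>x. x \<in> P \<Longrightarrow> F x \<le> F1" by blast
  \<comment> \<open>The barrier is at most \<open>9 * \<delta>\<^sup>2\<close> on the small ball, so
    its multiple does not use up more than the gap.\<close>
  define \<epsilon> where "\<epsilon> = (M - F1) / (9 * \<delta>\<^sup>2)"
  have \<epsilon>: "\<epsilon> > 0" using F1 \<delta> by (simp add: \<epsilon>_def)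
  define W where "W x = F x + \<epsilon> * (b x - b z)" for x
  have Wbd: "W x \<le> M" if x: "x \<in> sphere z r" for x
  proof (cases "x \<in> P")
    case True
    have "b x \<le> (3 * \<delta>)\<^sup>2" unfolding b_def using q[of x] x \<delta> by (intro power_mono) auto
    then have "b x - b z \<le> 9 * \<delta>\<^sup>2"
      unfolding bz by (simp add: power_mult_distrib) (use zero_le_power2[of \<delta>] in linarith)
    then have "\<epsilon> * (b x - b z) \<le> \<epsilon> * (9 * \<delta>\<^sup>2)" using \<epsilon> by (intro mult_left_mono) auto
    also have "\<dots> = M - F1" using \<delta> by (simp add: \<epsilon>_def)
    finally show ?thesis using F1(2)[OF True] by (simp add: W_def)
  next
    case False
    then have "R < norm (x - c)" using x by (auto simp: P_def dist_norm norm_minus_commute)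
    then have "R\<^sup>2 \<le> s x" unfolding s_def using R by (intro power_mono) auto
    then have "b x \<le> (2 * \<delta>)\<^sup>2"
      unfolding b_def using q[of x] x \<delta> by (intro power_mono) (auto simp: \<kappa>_def)
    then have "\<epsilon> * (b x - b z) \<le> 0" using \<epsilon> bz by (simp add: mult_le_0_iff)
    moreover have "F x \<le> M" using le[of x] sub x by auto
    ultimately show ?thesis by (simp add: W_def)
  qed
  have Wz: "W z = M" by (simp add: W_def z)
  have contW: "continuous_on (cball z r) W"
    unfolding W_def by (intro continuous_intros contb continuous_on_subset[OF contF sub])
  obtain \<xi>0 where \<xi>0: "\<xi>0 \<in> cball z r" "\<And>x. x \<in> cball z r \<Longrightarrow> W x \<le> W \<xi>0"
    using continuous_attains_sup[OF compact_cball _ contW] r by auto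
  \<comment> \<open>A maximizer on the sphere has value at most \<open>M\<close>, which is the value
    at the centre \<open>z\<close>; in that case \<open>z\<close> itself is an interior
    maximizer.\<close>
  have "\<exists>\<xi>\<in>ball z r. \<forall>x\<in>cball z r. W x \<le> W \<xi>"
  proof (cases "\<xi>0 \<in> ball z r")
    case False
    then have "W \<xi>0 \<le> M" using \<xi>0(1) by (intro Wbd) auto
    then show ?thesis using \<xi>0(2) Wz r by (intro bexI[of _ z]) (force simp: intro: order_trans)+
  qed (use \<xi>0 in blast)
  then obtain \<xi> where \<xi>: "\<xi> \<in> ball z r" and max: "\<And>x. x \<in> cball z r \<Longrightarrow> W x \<le> W \<xi>" by blast
  have \<xi>S: "\<xi> \<in> S" using \<xi> sub by auto
  define d where "d = \<xi> - c"
  define k where "k = \<kappa> - s \<xi>"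
  have k: "0 < k" "k \<le> 3 * \<delta>" using q[of \<xi>] \<xi> \<delta> by (auto simp: k_def)
  have nd: "R / 2 \<le> norm d" "norm d \<le> 2 * R"
    using norm_triangle_ineq3[of "\<xi> - c" "z - c"] \<xi> r
    by (auto simp: d_def R_def dist_norm norm_minus_commute)
  \<comment> \<open>First- and second-order conditions for \<open>W\<close> at its interior maximum,
    solved for the derivatives of \<open>F\<close>. The term with factor 8 comes from the convexity
    of the barrier and has no small factor \<open>k\<close>.\<close>
  have test: "F' \<xi> v = 4 * \<epsilon> * k * (d \<bullet> v)"
    "F'' \<xi> v v \<le> 4 * \<epsilon> * k * (norm v)\<^sup>2 - 8 * \<epsilon> * (d \<bullet> v)\<^sup>2" for v
  proof -
    define \<rho> where "\<rho> = r - norm (\<xi> - z)"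
    have \<rho>: "\<rho> > 0" using \<xi> by (simp add: \<rho>_def dist_norm norm_minus_commute)
    define e where "e = \<rho> / (norm v + 1)"
    have e: "e > 0" using \<rho> by (simp add: e_def add_nonneg_pos)
    have inb: "\<xi> + t *\<^sub>R v \<in> cball z r" if "\<bar>t\<bar> < e" for t
    proof -
      have "norm (t *\<^sub>R v) \<le> \<bar>t\<bar> * (norm v + 1)" by (simp add: mult_left_mono)
      also have "\<dots> \<le> e * (norm v + 1)" using that by (intro mult_right_mono) auto
      also have "\<dots> = \<rho>" unfolding e_def using norm_ge_zero[of v] by (simp add: add_nonneg_eq_0_iff)
      finally have "norm ((\<xi> - z) + t *\<^sub>R v) \<le> r"
        using norm_triangle_ineq[of "\<xi> - z" "t *\<^sub>R v"] by (simp add: \<rho>_def)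
      then show ?thesis by (simp add: dist_norm norm_minus_commute algebra_simps)
    qed
    define \<phi> where "\<phi> t = W (\<xi> + t *\<^sub>R v)" for t
    define \<phi>' where "\<phi>' t = F' (\<xi> + t *\<^sub>R v) v
        - \<epsilon> * (4 * (\<kappa> - s (\<xi> + t *\<^sub>R v)) * ((\<xi> + t *\<^sub>R v - c) \<bullet> v))" for t
    have s_exp: "s (\<xi> + t *\<^sub>R v) = s \<xi> + 2 * t * (d \<bullet> v) + t\<^sup>2 * (norm v)\<^sup>2" for t
    proof -
      have eq: "\<xi> + t *\<^sub>R v - c = d + t *\<^sub>R v" by (simp add: d_def)
      show ?thesis
        unfolding s_def eq d_def[symmetric] power2_norm_eq_inner
        by (simp add: inner_add_left inner_add_right inner_commute algebra_simps power2_eq_square)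
    qed
    have line: "((\<lambda>t. \<xi> + t *\<^sub>R v) has_derivative (\<lambda>t. t *\<^sub>R v)) (at t)" for t
      by (auto intro!: derivative_eq_intros)
    have s_der: "((\<lambda>t. s (\<xi> + t *\<^sub>R v)) has_real_derivative 2 * ((\<xi> + t *\<^sub>R v - c) \<bullet> v)) (at t)" for t
      unfolding s_exp by (auto intro!: derivative_eq_intros
          simp: d_def inner_add_left inner_diff_left power2_norm_eq_inner algebra_simps)
    have d1: "(\<phi> has_real_derivative \<phi>' t) (at t)" if "\<bar>t\<bar> < e" for t
    proof -
      have x: "\<xi> + t *\<^sub>R v \<in> S" using inb[OF that] sub by blast
      have "((\<lambda>t. F (\<xi> + t *\<^sub>R v)) has_derivative (\<lambda>h. F' (\<xi> + t *\<^sub>R v) (h *\<^sub>R v))) (at t)"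
        using has_derivative_compose[OF line dF[OF x]] .
      moreover have "(\<lambda>h. F' (\<xi> + t *\<^sub>R v) (h *\<^sub>R v)) = (*) (F' (\<xi> + t *\<^sub>R v) v)"
        using linear_cmul[OF has_derivative_linear[OF dF[OF x]]] by (auto simp: fun_eq_iff)
      ultimately have "((\<lambda>t. F (\<xi> + t *\<^sub>R v)) has_real_derivative F' (\<xi> + t *\<^sub>R v) v) (at t)"
        by (simp add: has_field_derivative_def)
      then show ?thesis
        unfolding \<phi>_def \<phi>'_def W_def b_def
        by (auto intro!: derivative_eq_intros s_der simp: algebra_simps)
    qed
    have d2: "(\<phi>' has_real_derivative
        F'' \<xi> v v - \<epsilon> * (4 * (k * (norm v)\<^sup>2 - 2 * (d \<bullet> v) * (d \<bullet> v)))) (at 0)"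
    proof -
      have "((\<lambda>y. F' y v) has_derivative F'' \<xi> v) (at (\<xi> + 0 *\<^sub>R v))" using d2F[OF \<xi>S] by simp
      from has_derivative_compose[OF line[of 0] this]
      have "((\<lambda>t. F' (\<xi> + t *\<^sub>R v) v) has_derivative (\<lambda>h. F'' \<xi> v (h *\<^sub>R v))) (at 0)" .
      moreover have "(\<lambda>h. F'' \<xi> v (h *\<^sub>R v)) = (*) (F'' \<xi> v v)"
        using linear_cmul[OF has_derivative_linear[OF d2F[OF \<xi>S]]] by (auto simp: fun_eq_iff)
      ultimately have F: "((\<lambda>t. F' (\<xi> + t *\<^sub>R v) v) has_real_derivative F'' \<xi> v v) (at 0)"
        by (simp add: has_field_derivative_def)
      have lin: "((\<lambda>t. (\<xi> + t *\<^sub>R v - c) \<bullet> v) has_real_derivative (norm v)\<^sup>2) (at 0)"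
        by (auto intro!: derivative_eq_intros simp: inner_add_left inner_diff_left power2_norm_eq_inner)
      show ?thesis
        unfolding \<phi>'_def
        by (rule derivative_eq_intros F s_der lin refl | simp add: k_def d_def algebra_simps)+
    qed
    have max': "\<phi> t \<le> \<phi> 0" if "\<bar>t\<bar> < e" for t
      using max[OF inb[OF that]] by (simp add: \<phi>_def)
    note t = local_max_second_derivative_nonpos[OF d1 e d2 max']
    show "F' \<xi> v = 4 * \<epsilon> * k * (d \<bullet> v)" using t(1) by (simp add: \<phi>'_def k_def d_def)
    show "F'' \<xi> v v \<le> 4 * \<epsilon> * k * (norm v)\<^sup>2 - 8 * \<epsilon> * (d \<bullet> v)\<^sup>2"
      using t(2) by (simp add: algebra_simps power2_eq_square)
  qed
  obtain u :: "'i \<Rightarrow> 'a" where u: "\<And>i. norm (u i) \<le> C"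
      "\<And>\<xi>. m * (norm \<xi>)\<^sup>2 \<le> (\<Sum>i\<in>UNIV. (u i \<bullet> \<xi>)\<^sup>2)"
      "0 \<le> (\<Sum>i\<in>UNIV. F'' \<xi> (u i) (u i) - F' \<xi> (B \<xi> (u i)))"
    using ell[OF \<xi>S] by blast
  have bound: "F'' \<xi> (u i) (u i) - F' \<xi> (B \<xi> (u i)) \<le>
      \<epsilon> * (12 * \<delta> * C\<^sup>2 * (1 + 2 * R * K)) - 8 * \<epsilon> * (u i \<bullet> d)\<^sup>2" for i
  proof -
    let ?v = "u i"
    have "- (d \<bullet> B \<xi> ?v) \<le> norm d * norm (B \<xi> ?v)"
      using Cauchy_Schwarz_ineq2[of d "B \<xi> ?v"] by linarith
    also have "\<dots> \<le> (2 * R) * (K * (norm ?v)\<^sup>2)"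
      using nd B[OF \<xi>S] R by (intro mult_mono) auto
    finally have "(norm ?v)\<^sup>2 - d \<bullet> B \<xi> ?v \<le> (norm ?v)\<^sup>2 * (1 + 2 * R * K)" by (simp add: algebra_simps)
    also have "\<dots> \<le> C\<^sup>2 * (1 + 2 * R * K)"
      using u(1)[of i] R K by (intro mult_right_mono power_mono) auto
    finally have *: "(norm ?v)\<^sup>2 - d \<bullet> B \<xi> ?v \<le> C\<^sup>2 * (1 + 2 * R * K)" .
    have "F'' \<xi> ?v ?v - F' \<xi> (B \<xi> ?v) \<le> 4 * \<epsilon> * k * ((norm ?v)\<^sup>2 - d \<bullet> B \<xi> ?v) - 8 * \<epsilon> * (?v \<bullet> d)\<^sup>2"
      using test(1)[of "B \<xi> ?v"] test(2)[of ?v] by (simp add: algebra_simps inner_commute)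
    also have "4 * \<epsilon> * k * ((norm ?v)\<^sup>2 - d \<bullet> B \<xi> ?v) \<le> 4 * \<epsilon> * k * (C\<^sup>2 * (1 + 2 * R * K))"
      using * \<epsilon> k by (intro mult_left_mono) auto
    also have "\<dots> \<le> 4 * \<epsilon> * (3 * \<delta>) * (C\<^sup>2 * (1 + 2 * R * K))"
      using \<epsilon> k R K by (intro mult_right_mono mult_left_mono) auto
    finally show ?thesis by (simp add: algebra_simps)
  qed
  have "0 \<le> (\<Sum>i\<in>(UNIV :: 'i set). \<epsilon> * (12 * \<delta> * C\<^sup>2 * (1 + 2 * R * K)) - 8 * \<epsilon> * (u i \<bullet> d)\<^sup>2)"
    using u(3) sum_mono[OF bound] by (rule order_trans)
  also have "\<dots> = \<epsilon> * (\<delta> * Q) - 8 * \<epsilon> * (\<Sum>i\<in>UNIV. (u i \<bullet> d)\<^sup>2)"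
    by (simp add: sum_subtractf sum_distrib_left Q_def)
  also have "\<dots> \<le> \<epsilon> * (\<delta> * Q) - 8 * \<epsilon> * (m * (R / 2)\<^sup>2)"
  proof -
    have "m * (R / 2)\<^sup>2 \<le> m * (norm d)\<^sup>2" using nd R m by (intro mult_left_mono power_mono) auto
    also have "\<dots> \<le> (\<Sum>i\<in>UNIV. (u i \<bullet> d)\<^sup>2)" by (rule u(2))
    finally show ?thesis using \<epsilon> by simp
  qed
  also have "\<dots> = \<epsilon> * (\<delta> * Q - 2 * m * R\<^sup>2)" by (simp add: algebra_simps power2_eq_square)
  also have "\<dots> < 0" using \<epsilon> \<delta>Q by (simp add: mult_pos_neg)
  finally show False by simp
qed

text \<open>Near a point where \<open>F < M\<close> the nearest point of the contact set lies on the
  boundary of a ball free of contact; the barrier argument excludes this configuration.\<close>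

lemma strong_maximum_principle:
  fixes F :: "'a::euclidean_space \<Rightarrow> real" and F'' :: "'a \<Rightarrow> 'a \<Rightarrow> 'a \<Rightarrow> real"
  assumes S: "open S"
    and dF: "\<And>x. x \<in> S \<Longrightarrow> (F has_derivative F' x) (at x)"
    and d2F: "\<And>x v. x \<in> S \<Longrightarrow> ((\<lambda>y. F' y v) has_derivative F'' x v) (at x)"
    and B: "\<And>x v. x \<in> S \<Longrightarrow> norm (B x v) \<le> K * (norm v)\<^sup>2" and K: "K \<ge> 0"
    and m: "m > 0" and C: "C \<ge> 0"
    and ell: "\<And>x. x \<in> S \<Longrightarrow> \<exists>u :: 'i::finite \<Rightarrow> 'a. (\<forall>i. norm (u i) \<le> C) \<and>
       (\<forall>\<xi>. m * (norm \<xi>)\<^sup>2 \<le> (\<Sum>i\<in>UNIV. (u i \<bullet> \<xi>)\<^sup>2)) \<and>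
       0 \<le> (\<Sum>i\<in>UNIV. F'' x (u i) (u i) - F' x (B x (u i)))"
    and le: "\<And>x. x \<in> S \<Longrightarrow> F x \<le> M" and x0: "x0 \<in> S" "F x0 = M"
  shows "\<exists>r>0. \<forall>x\<in>ball x0 r. F x = M"
proof -
  obtain \<rho> where \<rho>: "\<rho> > 0" "cball x0 \<rho> \<subseteq> S" using S x0(1) open_contains_cball by blast
  have contF: "continuous_on (cball x0 \<rho>) F"
    using dF has_derivative_continuous \<rho> by (intro continuous_at_imp_continuous_on) blast
  \<comment> \<open>Half the radius ensures that the contact point nearest to \<open>y\<close>, no
    further from \<open>y\<close> than \<open>x0\<close> is, stays in the open ball around
    \<open>x0\<close>.\<close>
  have "F y = M" if y: "y \<in> ball x0 (\<rho> / 2)" for y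
  proof (rule ccontr)
    assume "F y \<noteq> M"
    moreover have yS: "y \<in> cball x0 \<rho>" using y \<rho> by auto
    ultimately have Fy: "F y < M" using le[of y] \<rho> by force
    define T where "T = cball x0 \<rho> \<inter> F -` {M}"
    have "closed T" unfolding T_def using contF by (intro continuous_closed_preimage) auto
    moreover have "x0 \<in> T" using x0 \<rho> by (auto simp: T_def)
    ultimately obtain z where z: "z \<in> T" "\<And>x. x \<in> T \<Longrightarrow> dist y z \<le> dist y x"
      using distance_attains_inf[of T y] by blast
    have zy: "dist y z \<le> dist y x0" using z(2) \<open>x0 \<in> T\<close> .
    have R: "dist y z < \<rho> / 2" using zy y by (simp add: dist_commute)
    have zb: "z \<in> ball x0 \<rho>"
      using R y dist_triangle[of x0 z y] by (simp add: dist_commute)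
    have near: "F x < M" if "dist y x < dist y z" for x
    proof -
      have "x \<in> cball x0 \<rho>" using that R y dist_triangle[of x0 x y] by (simp add: dist_commute)
      moreover have "x \<notin> T" using z(2)[of x] that by auto
      ultimately show ?thesis using le[of x] \<rho> by (force simp: T_def)
    qed
    have ne: "z \<noteq> y" using z(1) Fy by (auto simp: T_def)
    define c where "c = midpoint y z"
    have half: "x = (1/2) *\<^sub>R x + (1/2) *\<^sub>R x" for x :: 'a
      by (simp flip: scaleR_left_distrib)
    have cy: "c = y + (1/2) *\<^sub>R (z - y)"
      using half[of y] by (simp add: c_def midpoint_def algebra_simps)
    have zc: "z - c = (1/2) *\<^sub>R (z - y)"
      using half[of "z - y"] by (simp add: cy algebra_simps)
    text \<open>Passing to the ball with diameter \<open>yz\<close> makes \<open>z\<close> the only contact point.\<close>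
    have near': "dist y x < dist y z" if "norm (x - c) \<le> norm (z - c)" "x \<noteq> z" for x
    proof -
      define p where "p = x - y"
      define w where "w = z - y"
      have xc: "x - c = p - (1/2) *\<^sub>R w" and zc': "z - c = (1/2) *\<^sub>R w"
        using zc by (auto simp: p_def w_def cy)
      have "(norm (x - c))\<^sup>2 \<le> (norm (z - c))\<^sup>2" using that by (intro power_mono) auto
      \<comment> \<open>With \<open>y\<close> as origin, the ball having the segment from
        \<open>y\<close> to \<open>z\<close> as diameter is given by this inequality.\<close>
      then have 1: "p \<bullet> p \<le> p \<bullet> w"
        unfolding xc zc' power2_norm_eq_inner
        by (simp add: inner_diff_left inner_diff_right inner_commute algebra_simps)
      have "p \<noteq> w" using that by (simp add: p_def w_def)
      then have "0 < (p - w) \<bullet> (p - w)" by simp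
      then have "2 * (p \<bullet> w) < p \<bullet> p + w \<bullet> w"
        by (simp add: inner_diff_left inner_diff_right inner_commute)
      with 1 have "p \<bullet> p < w \<bullet> w" by linarith
      then have "norm p < norm w" by (simp add: norm_lt)
      then show ?thesis by (simp add: p_def w_def dist_norm norm_minus_commute)
    qed
    show False
    proof (rule hopf_barrier_contradiction[where S = "ball x0 \<rho>" and F = F and F' = F' and F'' = F'' and B = B
          and K = K and m = m and C = C and M = M and z = z and c = c and ?'i = 'i])
      show "F z = M" using z(1) by (simp add: T_def)
      show "c \<noteq> z" using zc ne by auto
    qed (use \<rho> dF d2F B K m C ell le zb near near' in \<open>auto simp: subset_iff\<close>)
  qed
  then show ?thesis using \<rho> by (intro exI[of _ "\<rho> / 2"]) auto
qed

section \<open>Estimates in a chart\<close>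

lemma smooth_on_differentiable: "smooth_on S f \<Longrightarrow> x \<in> S \<Longrightarrow> f differentiable (at x)"
  unfolding smooth_on_def using Ck_on.simps(2)[of 0 S f] by blast

lemma smooth_on_frechet_derivative:
  "smooth_on S f \<Longrightarrow> smooth_on S (\<lambda>x. frechet_derivative f (at x) v)"
  unfolding smooth_on_def using Ck_on.simps(2) by blast

lemma smooth_on_partial: "smooth_on S f \<Longrightarrow> smooth_on S (partial i f)"
  unfolding partial_def[abs_def] by (rule smooth_on_frechet_derivative)

lemma smooth_on_continuous_on: "smooth_on S f \<Longrightarrow> continuous_on S f"
  unfolding smooth_on_def using Ck_on.simps(1) by blast

lemma has_derivative_partial:
  assumes "f differentiable (at x)"
  shows "(f has_derivative (\<lambda>v. \<Sum>i\<in>UNIV. v $ i * partial i f x)) (at x)"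
proof -
  have d: "(f has_derivative frechet_derivative f (at x)) (at x)"
    using assms frechet_derivative_works by blast
  have "frechet_derivative f (at x) v = (\<Sum>i\<in>UNIV. v $ i * partial i f x)" for v
  proof -
    have "v = (\<Sum>i\<in>UNIV. v $ i *\<^sub>R axis i 1)"
      using basis_expansion[of v] by (simp add: scalar_mult_eq_scaleR)
    then have "frechet_derivative f (at x) v = frechet_derivative f (at x) (\<Sum>i\<in>UNIV. v $ i *\<^sub>R axis i 1)"
      by simp
    also have "\<dots> = (\<Sum>i\<in>UNIV. v $ i * partial i f x)"
      using has_derivative_linear[OF d] by (simp add: linear_sum linear_cmul partial_def)
    finally show ?thesis .
  qed
  then have "frechet_derivative f (at x) = (\<lambda>v. \<Sum>i\<in>UNIV. v $ i * partial i f x)" by auto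
  with d show ?thesis by simp
qed

lemma bounded_finite_family:
  fixes f :: "'i::finite \<Rightarrow> 'a::topological_space \<Rightarrow> real"
  assumes "compact D" "\<And>i. continuous_on D (f i)"
  shows "\<exists>M\<ge>0. \<forall>i. \<forall>x\<in>D. \<bar>f i x\<bar> \<le> M"
proof -
  have "continuous_on D (\<lambda>x. \<Sum>i\<in>UNIV. \<bar>f i x\<bar>)" using assms by (intro continuous_intros) auto
  then have "bounded ((\<lambda>x. \<Sum>i\<in>UNIV. \<bar>f i x\<bar>) ` D)"
    using assms compact_continuous_image compact_imp_bounded by blast
  then obtain M where M: "\<And>x. x \<in> D \<Longrightarrow> norm (\<Sum>i\<in>UNIV. \<bar>f i x\<bar>) \<le> M"
    unfolding bounded_iff by blast
  have "\<bar>f i x\<bar> \<le> max M 0" if "x \<in> D" for i x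
  proof -
    have "\<bar>f i x\<bar> \<le> (\<Sum>i\<in>UNIV. \<bar>f i x\<bar>)" by (rule member_le_sum) auto
    with M[OF that] show ?thesis by simp
  qed
  then show ?thesis by (intro exI[of _ "max M 0"]) auto
qed

section \<open>Bounds on the metric, its inverse and the Christoffel symbols\<close>

lemma pos_def_matrix_invertible: "pos_def_matrix G \<Longrightarrow> invertible G"
  unfolding invertible_left_inverse matrix_left_invertible_ker pos_def_matrix_def
  by (metis inner_zero_right less_irrefl)

text \<open>Column \<open>l\<close> of the inverse solves \<open>G *v y = axis l 1\<close>;
  coercivity bounds g |y|^2 by the component of \<open>y\<close> in that direction, hence by
  |y|.\<close>

lemma matrix_inv_entry_bound:
  fixes G :: "real^'n^'n"
  assumes "invertible G" and g: "g > 0" "\<And>x. g * (norm x)\<^sup>2 \<le> x \<bullet> (G *v x)"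
  shows "\<bar>matrix_inv G $ k $ l\<bar> \<le> 1 / g"
proof -
  define y where "y = matrix_inv G *v axis l 1"
  have "G *v y = axis l 1"
  proof -
    have "G ** matrix_inv G = mat 1"
      using assms(1) someI_ex[of "\<lambda>B. G ** B = mat 1 \<and> B ** G = mat 1"]
      unfolding invertible_def matrix_inv_def by blast
    then show ?thesis by (simp add: y_def matrix_vector_mul_assoc)
  qed
  then have "g * (norm y)\<^sup>2 \<le> y \<bullet> axis l 1" using g(2)[of y] by simp
  also have "\<dots> \<le> norm y" using norm_cauchy_schwarz[of y "axis l 1"] by simp
  finally have *: "norm y * (g * norm y) \<le> norm y * 1" by (simp add: power2_eq_square algebra_simps)
  have "g * norm y \<le> 1"
  proof (cases "y = 0")
    case False then show ?thesis using * mult_le_cancel_left_pos[of "norm y"] by simp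
  qed simp
  moreover have "\<bar>y $ k\<bar> \<le> norm y" by (rule component_le_norm_cart)
  moreover have "y $ k = matrix_inv G $ k $ l"
    by (simp add: y_def matrix_vector_mult_basis column_def)
  ultimately show ?thesis using g(1) by (simp add: field_simps) (smt (verit) mult_left_mono)
qed

lemma quadratic_form_sum: "x \<bullet> (A *v x) = (\<Sum>i\<in>UNIV. \<Sum>j\<in>UNIV. x $ i * A $ i $ j * x $ j)"
  by (simp add: inner_vec_def matrix_vector_mult_def sum_distrib_left mult.assoc)

lemma quadratic_form_entry_bound:
  fixes A :: "real^'n^'n"
  assumes "\<And>i j. \<bar>A $ i $ j\<bar> \<le> c"
  shows "\<bar>x \<bullet> (A *v x)\<bar> \<le> (real CARD('n))\<^sup>2 * c * (norm x)\<^sup>2"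
proof -
  have "\<bar>x \<bullet> (A *v x)\<bar> \<le> (\<Sum>i\<in>UNIV. \<Sum>j\<in>UNIV. \<bar>x $ i * A $ i $ j * x $ j\<bar>)"
    unfolding quadratic_form_sum by (intro order_trans[OF sum_abs] sum_mono order_trans[OF sum_abs]) simp
  also have "\<dots> \<le> (\<Sum>i\<in>(UNIV::'n set). \<Sum>j\<in>(UNIV::'n set). norm x * c * norm x)"
    unfolding abs_mult
    by (intro sum_mono mult_mono component_le_norm_cart assms)
      (auto intro!: mult_nonneg_nonneg order_trans[OF abs_ge_zero assms])
  also have "\<dots> = (real CARD('n))\<^sup>2 * c * (norm x)\<^sup>2" by (simp add: power2_eq_square)
  finally show ?thesis .
qed

text \<open>The quadratic form attains a positive minimum over \<open>D\<close> times the unit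
  sphere, and homogeneity extends the bound to all vectors.\<close>

lemma pos_def_matrix_uniform:
  fixes G :: "'a::t2_space \<Rightarrow> real^'n^'n"
  assumes D: "compact D" and cont: "\<And>i j. continuous_on D (\<lambda>x. G x $ i $ j)"
    and pd: "\<And>x. x \<in> D \<Longrightarrow> pos_def_matrix (G x)"
  shows "\<exists>g>0. \<forall>x\<in>D. \<forall>v. g * (norm v)\<^sup>2 \<le> v \<bullet> (G x *v v)"
proof (cases "D = {}")
  case False
  let ?P = "D \<times> sphere (0 :: real^'n) 1"
  define q where "q p = (\<Sum>i\<in>UNIV. \<Sum>j\<in>UNIV. snd p $ i * G (fst p) $ i $ j * snd p $ j)" for p
  have q: "q (x, v) = v \<bullet> (G x *v v)" for x v by (simp add: q_def quadratic_form_sum)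
  have c: "continuous_on ?P (\<lambda>p. G (fst p) $ i $ j)" for i j
    by (rule continuous_on_compose2[OF cont]) (auto intro: continuous_intros)
  have "continuous_on ?P q" unfolding q_def
    by (intro continuous_intros c)
  moreover have "compact ?P" using D by (intro compact_Times) auto
  moreover have "?P \<noteq> {}" using False by (auto intro!: exI[of _ "axis undefined 1"])
  ultimately obtain p where p: "p \<in> ?P" "\<And>p'. p' \<in> ?P \<Longrightarrow> q p \<le> q p'"
    using continuous_attains_inf[of ?P q] by blast
  obtain x0 v0 where p0: "p = (x0, v0)" by (cases p)
  then have "v0 \<noteq> 0" "x0 \<in> D" using p(1) by auto
  then have "q p > 0" using pd by (auto simp: p0 q pos_def_matrix_def)
  moreover have "q p * (norm v)\<^sup>2 \<le> v \<bullet> (G x *v v)" if "x \<in> D" for x v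
  proof (cases "v = 0")
    case False
    have "q p \<le> q (x, v /\<^sub>R norm v)" using that False by (intro p(2)) auto
    also have "\<dots> = (v \<bullet> (G x *v v)) / (norm v)\<^sup>2"
      by (simp add: q matrix_vector_mult_scaleR power2_eq_square divide_inverse)
    finally show ?thesis using False by (simp add: field_simps)
  qed simp
  ultimately show ?thesis by blast
qed (auto intro: exI[of _ 1])

text \<open>The characterization of the Levi-Civita connection, applied to the Christoffel symbols
  themselves, returns torsion-freeness.\<close>

lemma christoffel_symmetric:
  assumes "open U" "x \<in> U" "\<And>y. y \<in> U \<Longrightarrow> pos_def_matrix (G y)"
  shows "christoffel G k i j x = christoffel G k j i x"
proof -
  have "G y $ i $ j = G y $ j $ i" if "y \<in> U" for y i j
  proof -
    have "transpose (G y) $ i $ j = G y $ i $ j" using assms(3)[OF that] by (simp add: pos_def_matrix_def)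
    then show ?thesis by (simp add: transpose_def)
  qed
  from christoffel_levi_civita[where G = G and \<Gamma> = "\<lambda>k i j. christoffel G k i j x",
      OF assms(1,2) this pos_def_matrix_invertible[OF assms(3)[OF assms(2)]]]
  show ?thesis by blast
qed

text \<open>Closedness symmetrizes the partial derivatives and torsion-freeness the Christoffel
  term, which makes the tensor diagonalizable relative to the metric.\<close>

lemma cov_deriv_symmetric:
  assumes "open U" "x \<in> U" "\<And>y. y \<in> U \<Longrightarrow> pos_def_matrix (G y)"
    and "\<And>i j. partial i (\<lambda>y. w y $ j) x = partial j (\<lambda>y. w y $ i) x"
  shows "transpose (cov_deriv G w x) = cov_deriv G w x"
  using christoffel_symmetric[OF assms(1-3)] assms(4)
  by (simp add: vec_eq_iff transpose_def cov_deriv_def)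

lemma christoffel_bound:
  fixes G :: "real^'n::finite \<Rightarrow> real^'n^'n"
  assumes "\<And>k l. \<bar>matrix_inv (G x) $ k $ l\<bar> \<le> a"
    and "\<And>l i j. \<bar>partial l (\<lambda>y. G y $ i $ j) x\<bar> \<le> M"
  shows "\<bar>christoffel G k i j x\<bar> \<le> 3/2 * real CARD('n) * a * M"
proof -
  define d where "d l = partial i (\<lambda>y. G y $ j $ l) x + partial j (\<lambda>y. G y $ i $ l) x
      - partial l (\<lambda>y. G y $ i $ j) x" for l
  have d: "\<bar>d l\<bar> \<le> 3 * M" for l
    using assms(2)[of i j l] assms(2)[of j i l] assms(2)[of l i j] unfolding d_def by linarith
  have "\<bar>\<Sum>l\<in>UNIV. matrix_inv (G x) $ k $ l * d l\<bar> \<le> (\<Sum>l\<in>UNIV. \<bar>matrix_inv (G x) $ k $ l\<bar> * \<bar>d l\<bar>)"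
    using sum_abs[of "\<lambda>l. matrix_inv (G x) $ k $ l * d l" UNIV] by (simp add: abs_mult)
  also have "\<dots> \<le> (\<Sum>l\<in>(UNIV::'n set). a * (3 * M))"
    using assms(1) d by (intro sum_mono mult_mono) (auto intro: order_trans[OF abs_ge_zero])
  finally show ?thesis by (simp add: christoffel_def d_def)
qed

text \<open>The vector with components
  \<open>\<Gamma>\<^sup>k\<^sub>i\<^sub>j v\<^sup>i v\<^sup>j\<close>. It will be the map
  \<open>B\<close> of the maximum principle, the argument of the first-order term.\<close>

definition christoffel_form ::
  "(real^'n::finite \<Rightarrow> real^'n^'n) \<Rightarrow> real^'n \<Rightarrow> real^'n \<Rightarrow> real^'n" where
  "christoffel_form G x v = (\<chi> k. \<Sum>j\<in>UNIV. \<Sum>i\<in>UNIV. christoffel G k i j x * v $ i * v $ j)"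

lemma christoffel_form_bound:
  fixes G :: "real^'n::finite \<Rightarrow> real^'n^'n"
  assumes "\<And>k i j. \<bar>christoffel G k i j x\<bar> \<le> c"
  shows "norm (christoffel_form G x v) \<le> real CARD('n) ^ 3 * c * (norm v)\<^sup>2"
proof -
  have "norm (christoffel_form G x v) \<le> (\<Sum>k\<in>UNIV. \<bar>christoffel_form G x v $ k\<bar>)"
    by (rule norm_le_l1_cart)
  also have "\<dots> \<le> (\<Sum>k\<in>(UNIV::'n set). (real CARD('n))\<^sup>2 * c * (norm v)\<^sup>2)"
  proof (rule sum_mono)
    fix k
    have "christoffel_form G x v $ k = v \<bullet> ((\<chi> j i. christoffel G k i j x) *v v)"
      by (simp add: christoffel_form_def quadratic_form_sum mult_ac)
    then show "\<bar>christoffel_form G x v $ k\<bar> \<le> (real CARD('n))\<^sup>2 * c * (norm v)\<^sup>2"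
      using quadratic_form_entry_bound[of "\<chi> j i. christoffel G k i j x" c v] assms by simp
  qed
  finally show ?thesis by (simp add: power2_eq_square power3_eq_cube mult_ac)
qed

text \<open>When \<open>w1 - w0\<close> is the coordinate gradient of a potential, this splits its
  Hessian into the ordinary second derivative and the gradient applied to the Christoffel vector:
  the shape \<open>F'' - F' B\<close> that the maximum principle expects.\<close>

lemma cov_deriv_diff_quadratic_form:
  "v \<bullet> ((cov_deriv G w1 x - cov_deriv G w0 x) *v v) =
     (\<Sum>j\<in>UNIV. v $ j * (\<Sum>i\<in>UNIV. v $ i *
        (partial i (\<lambda>y. w1 y $ j) x - partial i (\<lambda>y. w0 y $ j) x)))
     - (w1 x - w0 x) \<bullet> christoffel_form G x v"
proof -
  have "(w1 x - w0 x) \<bullet> christoffel_form G x v =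
      (\<Sum>k\<in>UNIV. \<Sum>j\<in>UNIV. \<Sum>i\<in>UNIV. (w1 x - w0 x) $ k * (christoffel G k i j x * v $ i * v $ j))"
    by (simp add: inner_vec_def christoffel_form_def sum_distrib_left)
  also have "\<dots> = (\<Sum>j\<in>UNIV. \<Sum>k\<in>UNIV. \<Sum>i\<in>UNIV. (w1 x - w0 x) $ k * (christoffel G k i j x * v $ i * v $ j))"
    by (rule sum.swap)
  also have "\<dots> = (\<Sum>j\<in>UNIV. \<Sum>i\<in>UNIV. \<Sum>k\<in>UNIV. (w1 x - w0 x) $ k * (christoffel G k i j x * v $ i * v $ j))"
    by (rule sum.cong[OF refl], rule sum.swap)
  finally have eq: "(w1 x - w0 x) \<bullet> christoffel_form G x v = \<dots>" .
  have entry: "v $ j * (cov_deriv G w1 x - cov_deriv G w0 x) $ j $ i * v $ i =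
      v $ j * (v $ i * (partial i (\<lambda>y. w1 y $ j) x - partial i (\<lambda>y. w0 y $ j) x)) -
      (\<Sum>k\<in>UNIV. (w1 x - w0 x) $ k * (christoffel G k i j x * v $ i * v $ j))" for i j
  proof -
    have "(\<Sum>k\<in>UNIV. (w1 x - w0 x) $ k * (christoffel G k i j x * v $ i * v $ j)) =
        v $ j * v $ i * ((\<Sum>k\<in>UNIV. christoffel G k i j x * w1 x $ k) - (\<Sum>k\<in>UNIV. christoffel G k i j x * w0 x $ k))"
      unfolding sum_subtractf[symmetric] sum_distrib_left by (rule sum.cong) (auto simp: algebra_simps)
    then show ?thesis by (simp add: cov_deriv_def algebra_simps)
  qed
  show ?thesis
    unfolding quadratic_form_sum eq entry by (simp only: sum_subtractf sum_distrib_left)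
qed

lemma cov_deriv_entry_bound:
  fixes G :: "real^'n::finite \<Rightarrow> real^'n^'n"
  assumes "\<And>k i j. \<bar>christoffel G k i j x\<bar> \<le> c" "\<And>i j. \<bar>partial i (\<lambda>y. w y $ j) x\<bar> \<le> M"
    and "\<And>k. \<bar>w x $ k\<bar> \<le> M"
  shows "\<bar>cov_deriv G w x $ j $ i\<bar> \<le> M + real CARD('n) * c * M"
proof -
  have "\<bar>\<Sum>k\<in>UNIV. christoffel G k i j x * w x $ k\<bar> \<le> (\<Sum>k\<in>UNIV. \<bar>christoffel G k i j x\<bar> * \<bar>w x $ k\<bar>)"
    using sum_abs[of "\<lambda>k. christoffel G k i j x * w x $ k" UNIV] by (simp add: abs_mult)
  also have "\<dots> \<le> (\<Sum>k\<in>(UNIV::'n set). c * M)"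
    using assms by (intro sum_mono mult_mono) (auto intro: order_trans[OF abs_ge_zero])
  finally show ?thesis using assms(2)[of i j] by (simp add: cov_deriv_def)
qed

text \<open>Supplies the second derivative of the potential from the components of the two forms, in
  the same expression as the leading term of \<open>cov_deriv_diff_quadratic_form\<close>.\<close>

lemma has_derivative_inner_form:
  fixes w0 w1 :: "real^'n::finite \<Rightarrow> real^'n"
  assumes "\<And>j. (\<lambda>y. w0 y $ j) differentiable (at x)" "\<And>j. (\<lambda>y. w1 y $ j) differentiable (at x)"
  shows "((\<lambda>y. (w1 y - w0 y) \<bullet> v) has_derivative (\<lambda>u. \<Sum>j\<in>UNIV. v $ j * (\<Sum>i\<in>UNIV. u $ i *
        (partial i (\<lambda>y. w1 y $ j) x - partial i (\<lambda>y. w0 y $ j) x)))) (at x)"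
proof -
  have "((\<lambda>y. \<Sum>j\<in>UNIV. v $ j * (w1 y $ j - w0 y $ j)) has_derivative (\<lambda>u. \<Sum>j\<in>UNIV. v $ j *
      ((\<Sum>i\<in>UNIV. u $ i * partial i (\<lambda>y. w1 y $ j) x) - (\<Sum>i\<in>UNIV. u $ i * partial i (\<lambda>y. w0 y $ j) x)))) (at x)"
    by (intro has_derivative_sum has_derivative_mult_right has_derivative_diff has_derivative_partial assms)
  then show ?thesis
    by (simp add: inner_vec_def mult.commute right_diff_distrib sum_subtractf)
qed

section \<open>Comparison and local constancy in one chart\<close>

text \<open>At the maximum the gradient vanishes, so the Christoffel term drops out and the Hessian
  is the ordinary second derivative, nonpositive along every line. The angle does not increase under
  such a change of tensor.\<close>

lemma chart_angle_at_max:
  fixes G :: "real^'n::finite \<Rightarrow> real^'n^'n" and w0 w1 :: "real^'n \<Rightarrow> real^'n"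
  assumes U: "open U" and pd: "\<And>x. x \<in> U \<Longrightarrow> pos_def_matrix (G x)"
    and w0: "\<And>j. smooth_on U (\<lambda>y. w0 y $ j)" and w1: "\<And>j. smooth_on U (\<lambda>y. w1 y $ j)"
    and c0: "\<And>x i j. x \<in> U \<Longrightarrow> partial i (\<lambda>y. w0 y $ j) x = partial j (\<lambda>y. w0 y $ i) x"
    and c1: "\<And>x i j. x \<in> U \<Longrightarrow> partial i (\<lambda>y. w1 y $ j) x = partial j (\<lambda>y. w1 y $ i) x"
    and dF: "\<And>x. x \<in> U \<Longrightarrow> (F has_derivative (\<lambda>v. (w1 x - w0 x) \<bullet> v)) (at x)"
    and x0: "x0 \<in> U" and max: "\<And>x. x \<in> U \<Longrightarrow> F x \<le> F x0"
  shows "rel_angle (G x0) (cov_deriv G w1 x0) \<le> rel_angle (G x0) (cov_deriv G w0 x0)"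
proof -
  let ?H = "cov_deriv G w1 x0 - cov_deriv G w0 x0"
  have s0: "transpose (cov_deriv G w0 x0) = cov_deriv G w0 x0"
    by (rule cov_deriv_symmetric[OF U x0 pd c0[OF x0]])
  have s1: "transpose (cov_deriv G w1 x0) = cov_deriv G w1 x0"
    by (rule cov_deriv_symmetric[OF U x0 pd c1[OF x0]])
  have sH: "transpose ?H = ?H" using s0 s1 by (simp add: transpose_def vec_eq_iff)
  obtain r where r: "r > 0" "ball x0 r \<subseteq> U" using U x0 open_contains_ball by blast
  have "v \<bullet> (?H *v v) \<le> 0" for v
  proof -
    \<comment> \<open>Keeps the line inside the ball of radius \<open>r\<close>; the
      \<open>+ 1\<close> covers \<open>v = 0\<close>.\<close>
    define e where "e = r / (norm v + 1)"
    have e: "e > 0" using r by (simp add: e_def add_nonneg_pos)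
    have inU: "x0 + t *\<^sub>R v \<in> U" if "\<bar>t\<bar> < e" for t
    proof -
      have "norm (t *\<^sub>R v) \<le> \<bar>t\<bar> * (norm v + 1)" by (simp add: mult_left_mono)
      also have "\<dots> < e * (norm v + 1)"
        using that norm_ge_zero[of v] by (intro mult_strict_right_mono) linarith+
      also have "\<dots> = r" unfolding e_def using norm_ge_zero[of v] by (simp add: add_nonneg_eq_0_iff)
      finally show ?thesis using r by (auto simp: dist_norm)
    qed
    define \<phi>' where "\<phi>' t = (w1 (x0 + t *\<^sub>R v) - w0 (x0 + t *\<^sub>R v)) \<bullet> v" for t
    define D where "D = (\<Sum>j\<in>UNIV. v $ j * (\<Sum>i\<in>UNIV. v $ i *
        (partial i (\<lambda>y. w1 y $ j) x0 - partial i (\<lambda>y. w0 y $ j) x0)))"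
    have line: "((\<lambda>t. x0 + t *\<^sub>R v) has_derivative (\<lambda>t. t *\<^sub>R v)) (at t)" for t
      by (auto intro!: derivative_eq_intros)
    have d1: "((\<lambda>t. F (x0 + t *\<^sub>R v)) has_real_derivative \<phi>' t) (at t)" if "\<bar>t\<bar> < e" for t
      using has_derivative_compose[OF line dF[OF inU[OF that]]]
      by (simp add: has_field_derivative_def \<phi>'_def mult.commute[of _ "_ \<bullet> _"])
    have d2: "(\<phi>' has_real_derivative D) (at 0)"
    proof -
      have *: "((\<lambda>y. (w1 y - w0 y) \<bullet> v) has_derivative (\<lambda>u. \<Sum>j\<in>UNIV. v $ j * (\<Sum>i\<in>UNIV. u $ i *
        (partial i (\<lambda>y. w1 y $ j) x0 - partial i (\<lambda>y. w0 y $ j) x0)))) (at (x0 + 0 *\<^sub>R v))"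
        using has_derivative_inner_form[of w0 x0 w1 v] smooth_on_differentiable[OF w0 x0]
          smooth_on_differentiable[OF w1 x0] by simp
      have "(\<lambda>t. \<Sum>j\<in>UNIV. v $ j * (\<Sum>i\<in>UNIV. (t *\<^sub>R v) $ i *
        (partial i (\<lambda>y. w1 y $ j) x0 - partial i (\<lambda>y. w0 y $ j) x0))) = (*) D"
        by (simp add: fun_eq_iff D_def sum_distrib_left sum_distrib_right mult_ac)
      moreover have "\<phi>' = (\<lambda>t. (w1 (x0 + t *\<^sub>R v) - w0 (x0 + t *\<^sub>R v)) \<bullet> v)"
        by (simp add: fun_eq_iff \<phi>'_def)
      ultimately show ?thesis
        using has_derivative_compose[OF line[of 0] *] by (simp only: has_field_derivative_def)
    qed
    have m: "F (x0 + t *\<^sub>R v) \<le> F (x0 + 0 *\<^sub>R v)" if "\<bar>t\<bar> < e" for t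
      using max inU[OF that] by simp
    from local_max_second_derivative_nonpos[OF d1 e d2 m] have D: "D \<le> 0" by blast
    have z: "(w1 x0 - w0 x0) \<bullet> u = 0" for u
    proof -
      have "(\<lambda>v. (w1 x0 - w0 x0) \<bullet> v) = (\<lambda>v. 0)"
        using differential_zero_maxmin[OF x0 U dF[OF x0]] max by blast
      then show ?thesis by metis
    qed
    show ?thesis using D unfolding cov_deriv_diff_quadratic_form z D_def by simp
  qed
  from rel_angle_mono_neg[OF pd[OF x0] s0 sH this] show ?thesis by simp
qed

text \<open>A closed ball inside \<open>V\<close> is compact, so metric, forms and their first
  derivatives are bounded there; these bounds turn the pointwise relation
  \<open>rel_angle_eq_elliptic\<close> into one with the fixed constants of the strong maximum
  principle.\<close>

lemma chart_strong_maximum: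
  fixes G :: "real^'n::finite \<Rightarrow> real^'n^'n" and w0 w1 :: "real^'n \<Rightarrow> real^'n"
  assumes U: "open U" and pd: "\<And>x. x \<in> U \<Longrightarrow> pos_def_matrix (G x)"
    and sG: "\<And>i j. smooth_on U (\<lambda>y. G y $ i $ j)"
    and w0: "\<And>j. smooth_on U (\<lambda>y. w0 y $ j)" and w1: "\<And>j. smooth_on U (\<lambda>y. w1 y $ j)"
    and c0: "\<And>x i j. x \<in> U \<Longrightarrow> partial i (\<lambda>y. w0 y $ j) x = partial j (\<lambda>y. w0 y $ i) x"
    and c1: "\<And>x i j. x \<in> U \<Longrightarrow> partial i (\<lambda>y. w1 y $ j) x = partial j (\<lambda>y. w1 y $ i) x"
    and dF: "\<And>x. x \<in> U \<Longrightarrow> (F has_derivative (\<lambda>v. (w1 x - w0 x) \<bullet> v)) (at x)"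
    and eq: "\<And>x. x \<in> U \<Longrightarrow> rel_angle (G x) (cov_deriv G w1 x) = rel_angle (G x) (cov_deriv G w0 x)"
    and V: "open V" "V \<subseteq> U" "x0 \<in> V" and max: "\<And>x. x \<in> V \<Longrightarrow> F x \<le> F x0"
  shows "\<exists>r>0. \<forall>x\<in>ball x0 r. F x = F x0"
proof -
  let ?N = "real CARD('n)"
  obtain \<rho> where \<rho>: "\<rho> > 0" "cball x0 \<rho> \<subseteq> V" using V open_contains_cball by blast
  let ?D = "cball x0 \<rho>"
  have DU: "?D \<subseteq> U" using \<rho> V by blast
  have cont: "continuous_on ?D f" if "smooth_on U f" for f :: "real^'n \<Rightarrow> real"
    using smooth_on_continuous_on[OF that] DU by (rule continuous_on_subset)
  obtain g where g: "g > 0" "\<And>x v. x \<in> ?D \<Longrightarrow> g * (norm v)\<^sup>2 \<le> v \<bullet> (G x *v v)"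
    using pos_def_matrix_uniform[of ?D G] cont[OF sG] pd DU by (metis compact_cball subsetD)
  obtain M1 where M1: "M1 \<ge> 0" "\<And>i j x. x \<in> ?D \<Longrightarrow> \<bar>G x $ i $ j\<bar> \<le> M1"
  proof -
    \<comment> \<open>Index pairs are packed into one finite type so that a single bound serves all
      entries; triples are treated in the same way below.\<close>
    define h where "h = (\<lambda>(i, j) x. G x $ i $ j)"
    have "continuous_on ?D (h p)" for p
      using cont[OF sG] by (cases p) (auto simp: h_def)
    then obtain M where M: "M \<ge> 0" "\<forall>p. \<forall>x\<in>?D. \<bar>h p x\<bar> \<le> M"
      using bounded_finite_family[OF compact_cball] by metis
    then have "\<bar>G x $ i $ j\<bar> \<le> M" if "x \<in> ?D" for i j x
      using that by (metis (mono_tags, lifting) h_def case_prod_conv)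
    with M(1) show thesis by (rule that)
  qed
  obtain M2 where M2: "\<And>l i j x. x \<in> ?D \<Longrightarrow> \<bar>partial l (\<lambda>y. G y $ i $ j) x\<bar> \<le> M2"
  proof -
    define h where "h = (\<lambda>(l, i, j). partial l (\<lambda>y. G y $ i $ j))"
    have "continuous_on ?D (h p)" for p
      using cont[OF smooth_on_partial[OF sG]] by (cases p) (auto simp: h_def)
    then obtain M where "\<forall>p. \<forall>x\<in>?D. \<bar>h p x\<bar> \<le> M"
      using bounded_finite_family[OF compact_cball] by metis
    then have "\<bar>partial l (\<lambda>y. G y $ i $ j) x\<bar> \<le> M" if "x \<in> ?D" for l i j x
      using that by (metis (mono_tags, lifting) h_def case_prod_conv)
    then show thesis by (rule that)
  qed
  have ex: "\<exists>M\<ge>0. \<forall>x\<in>?D. (\<forall>j. \<bar>w x $ j\<bar> \<le> M) \<and> (\<forall>i j. \<bar>partial i (\<lambda>y. w y $ j) x\<bar> \<le> M)"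
    if w: "\<And>j. smooth_on U (\<lambda>y. w y $ j)" for w
  proof -
    obtain a where a: "a \<ge> 0" "\<And>j x. x \<in> ?D \<Longrightarrow> \<bar>w x $ j\<bar> \<le> a"
      using bounded_finite_family[OF compact_cball, of x0 \<rho> "\<lambda>j x. w x $ j", OF cont[OF w]] by blast
    obtain b where b: "\<And>i j x. x \<in> ?D \<Longrightarrow> \<bar>partial i (\<lambda>y. w y $ j) x\<bar> \<le> b"
    proof -
      define h where "h = (\<lambda>(i, j). partial i (\<lambda>y. w y $ j))"
      have "continuous_on ?D (h p)" for p
        using cont[OF smooth_on_partial[OF w]] by (cases p) (auto simp: h_def)
      then obtain M where "\<forall>p. \<forall>x\<in>?D. \<bar>h p x\<bar> \<le> M"
        using bounded_finite_family[OF compact_cball] by metis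
      then have "\<bar>partial i (\<lambda>y. w y $ j) x\<bar> \<le> M" if "x \<in> ?D" for i j x
        using that by (metis (mono_tags, lifting) h_def case_prod_conv)
      then show thesis by (rule that)
    qed
    show ?thesis using a b by (intro exI[of _ "max a b"]) (auto simp: le_max_iff_disj)
  qed
  obtain A0 where A0: "A0 \<ge> 0" "\<And>j x. x \<in> ?D \<Longrightarrow> \<bar>w0 x $ j\<bar> \<le> A0"
      "\<And>i j x. x \<in> ?D \<Longrightarrow> \<bar>partial i (\<lambda>y. w0 y $ j) x\<bar> \<le> A0"
    using ex[OF w0] by blast
  obtain A1 where A1: "A1 \<ge> 0" "\<And>j x. x \<in> ?D \<Longrightarrow> \<bar>w1 x $ j\<bar> \<le> A1"
      "\<And>i j x. x \<in> ?D \<Longrightarrow> \<bar>partial i (\<lambda>y. w1 y $ j) x\<bar> \<le> A1"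
    using ex[OF w1] by blast
  define c where "c = 3/2 * ?N * (1 / g) * M2"
  have chr: "\<bar>christoffel G k i j x\<bar> \<le> c" if "x \<in> ?D" for k i j x
    unfolding c_def
  proof (rule christoffel_bound)
    fix k l show "\<bar>matrix_inv (G x) $ k $ l\<bar> \<le> 1 / g"
      using pos_def_matrix_invertible[OF pd] DU that g by (intro matrix_inv_entry_bound) blast+
  qed (rule M2[OF that])
  have c: "c \<ge> 0" using chr[of x0] \<rho>(1) by (meson abs_ge_zero centre_in_cball less_imp_le order_trans)
  define C0 where "C0 = ?N\<^sup>2 * (A0 + ?N * c * A0)"
  define C1 where "C1 = ?N\<^sup>2 * (A1 + ?N * c * A1)"
  define C where "C = max C0 C1"
  have "C0 \<ge> 0" using A0 c by (simp add: C0_def)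
  then have C: "C \<ge> 0" by (simp add: C_def)
  have S0: "\<bar>v \<bullet> (cov_deriv G w0 x *v v)\<bar> \<le> C * (norm v)\<^sup>2" if "x \<in> ?D" for x v
  proof -
    have "\<bar>v \<bullet> (cov_deriv G w0 x *v v)\<bar> \<le> C0 * (norm v)\<^sup>2" unfolding C0_def
      by (intro quadratic_form_entry_bound cov_deriv_entry_bound chr A0 that)
    also have "\<dots> \<le> C * (norm v)\<^sup>2" by (intro mult_right_mono) (auto simp: C_def)
    finally show ?thesis .
  qed
  have S1: "\<bar>v \<bullet> (cov_deriv G w1 x *v v)\<bar> \<le> C * (norm v)\<^sup>2" if "x \<in> ?D" for x v
  proof -
    have "\<bar>v \<bullet> (cov_deriv G w1 x *v v)\<bar> \<le> C1 * (norm v)\<^sup>2" unfolding C1_def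
      by (intro quadratic_form_entry_bound cov_deriv_entry_bound chr A1 that)
    also have "\<dots> \<le> C * (norm v)\<^sup>2" by (intro mult_right_mono) (auto simp: C_def)
    finally show ?thesis .
  qed
  \<comment> \<open>The \<open>+ 1\<close> makes the upper bound strictly positive even when
    \<open>M1 = 0\<close>.\<close>
  define \<Gamma> where "\<Gamma> = ?N\<^sup>2 * M1 + 1"
  have \<Gamma>: "\<Gamma> > 0" using M1(1) by (simp add: \<Gamma>_def add_nonneg_pos)
  have Gu: "v \<bullet> (G x *v v) \<le> \<Gamma> * (norm v)\<^sup>2" if "x \<in> ?D" for x v
  proof -
    have "v \<bullet> (G x *v v) \<le> ?N\<^sup>2 * M1 * (norm v)\<^sup>2"
      using quadratic_form_entry_bound[of "G x" M1 v, OF M1(2)[OF that]] by (simp add: abs_le_iff)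
    then show ?thesis
      unfolding \<Gamma>_def distrib_right mult_1 using zero_le_power2[of "norm v"] by linarith
  qed
  define F'' where "F'' x v u = (\<Sum>j\<in>UNIV. v $ j * (\<Sum>i\<in>UNIV. u $ i *
        (partial i (\<lambda>y. w1 y $ j) x - partial i (\<lambda>y. w0 y $ j) x)))" for x v u
  let ?S = "ball x0 \<rho>"
  have SD: "x \<in> ?D" if "x \<in> ?S" for x using that by simp
  have SU: "x \<in> U" if "x \<in> ?S" for x using that DU by (meson SD subsetD)
  show ?thesis
  proof (rule strong_maximum_principle[where S = ?S and F' = "\<lambda>x v. (w1 x - w0 x) \<bullet> v" and F'' = F''
        and B = "christoffel_form G" and K = "?N ^ 3 * c" and m = "1 / (\<Gamma> * (1 + (C / g)\<^sup>2))"
        and C = "sqrt (1 / g)" and ?'i = 'n])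
    fix x assume x: "x \<in> ?S"
    show "(F has_derivative (\<lambda>v. (w1 x - w0 x) \<bullet> v)) (at x)" by (rule dF[OF SU[OF x]])
    show "((\<lambda>y. (w1 y - w0 y) \<bullet> v) has_derivative F'' x v) (at x)" for v
      unfolding F''_def by (intro has_derivative_inner_form smooth_on_differentiable[OF w0 SU[OF x]]
          smooth_on_differentiable[OF w1 SU[OF x]])
    show "norm (christoffel_form G x v) \<le> ?N ^ 3 * c * (norm v)\<^sup>2" for v
      by (rule christoffel_form_bound[OF chr[OF SD[OF x]]])
    show "F x \<le> F x0" using max \<rho> SD[OF x] by blast
    let ?H = "cov_deriv G w1 x - cov_deriv G w0 x"
    have s0: "transpose (cov_deriv G w0 x) = cov_deriv G w0 x"
      by (rule cov_deriv_symmetric[OF U SU[OF x] pd c0[OF SU[OF x]]])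
    have s1: "transpose (cov_deriv G w1 x) = cov_deriv G w1 x"
      by (rule cov_deriv_symmetric[OF U SU[OF x] pd c1[OF SU[OF x]]])
    have sH: "transpose ?H = ?H" using s0 s1 by (simp add: transpose_def vec_eq_iff)
    have H: "cov_deriv G w0 x + ?H = cov_deriv G w1 x" by simp
    have "\<exists>u :: 'n \<Rightarrow> real^'n. (\<forall>i. norm (u i) \<le> sqrt (1 / g)) \<and>
     (\<forall>\<xi>. 1 / (\<Gamma> * (1 + (C / g)\<^sup>2)) * (norm \<xi>)\<^sup>2 \<le> (\<Sum>i\<in>UNIV. (u i \<bullet> \<xi>)\<^sup>2)) \<and>
     (\<Sum>i\<in>UNIV. u i \<bullet> (?H *v u i)) = 0"
      by (rule rel_angle_eq_elliptic[OF pd[OF SU[OF x]] s0 sH g(1) \<Gamma> C g(2)[OF SD[OF x]] Gu[OF SD[OF x]] S0[OF SD[OF x]]])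
        (simp_all only: H S1[OF SD[OF x]] eq[OF SU[OF x]])
    then obtain u :: "'n \<Rightarrow> real^'n" where u: "\<forall>i. norm (u i) \<le> sqrt (1 / g)"
      "\<forall>\<xi>. 1 / (\<Gamma> * (1 + (C / g)\<^sup>2)) * (norm \<xi>)\<^sup>2 \<le> (\<Sum>i\<in>UNIV. (u i \<bullet> \<xi>)\<^sup>2)"
      "(\<Sum>i\<in>UNIV. u i \<bullet> (?H *v u i)) = 0" by (elim exE conjE)
    from u(3) have "0 \<le> (\<Sum>i\<in>UNIV. F'' x (u i) (u i) - (w1 x - w0 x) \<bullet> christoffel_form G x (u i))"
      by (simp only: cov_deriv_diff_quadratic_form F''_def)
    with u(1,2) show "\<exists>u :: 'n \<Rightarrow> real^'n. (\<forall>i. norm (u i) \<le> sqrt (1 / g)) \<and>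
     (\<forall>\<xi>. 1 / (\<Gamma> * (1 + (C / g)\<^sup>2)) * (norm \<xi>)\<^sup>2 \<le> (\<Sum>i\<in>UNIV. (u i \<bullet> \<xi>)\<^sup>2)) \<and>
     0 \<le> (\<Sum>i\<in>UNIV. F'' x (u i) (u i) - (w1 x - w0 x) \<bullet> christoffel_form G x (u i))"
      by (intro exI[of _ u] conjI)
  next
    show "1 / (\<Gamma> * (1 + (C / g)\<^sup>2)) > 0"
      using \<Gamma> by (intro divide_pos_pos mult_pos_pos) (auto simp: add_pos_nonneg)
  qed (use \<rho> c g in auto)
qed

section \<open>Charts and tangent vectors\<close>

context
  fixes X :: "'a topology" and c :: "('a, 'n::finite) chart"
  assumes c: "chart_on X c"
begin

lemma chart_dom_subset: "chart_dom c \<subseteq> topspace X"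
  using c openin_subset by (auto simp: chart_on_def)

lemma topspace_chart_dom: "topspace (subtopology X (chart_dom c)) = chart_dom c"
  using chart_dom_subset by (simp add: Int_absorb1)

lemma chart_inj: "inj_on (chart_map c) (chart_dom c)"
  using c homeomorphic_imp_injective_map topspace_chart_dom unfolding chart_on_def by metis

lemma chart_inv_map: "p \<in> chart_dom c \<Longrightarrow> chart_inv c (chart_map c p) = p"
  using chart_inj by (simp add: chart_inv_def)

lemma chart_map_inv: "x \<in> chart_img c \<Longrightarrow> chart_map c (chart_inv c x) = x"
  by (simp add: chart_inv_def chart_img_def f_inv_into_f)

lemma chart_inv_dom: "x \<in> chart_img c \<Longrightarrow> chart_inv c x \<in> chart_dom c"
  by (simp add: chart_inv_def chart_img_def inv_into_into)

lemma chart_map_img: "p \<in> chart_dom c \<Longrightarrow> chart_map c p \<in> chart_img c"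
  by (simp add: chart_img_def)

lemma open_chart_img: "open (chart_img c)"
  using c by (simp add: chart_on_def)

lemma open_chart_image:
  assumes "openin X W" "W \<subseteq> chart_dom c"
  shows "open (chart_map c ` W)"
proof -
  have h: "homeomorphic_map (subtopology X (chart_dom c)) (top_of_set (chart_img c)) (chart_map c)"
    using c by (simp add: chart_on_def)
  have "openin (subtopology X (chart_dom c)) W"
    using assms by (metis inf.absorb_iff2 openin_subtopology_Int2)
  then have "openin (top_of_set (chart_img c)) (chart_map c ` W)"
    using homeomorphic_map_openness_eq[OF h] by blast
  then show ?thesis using open_chart_img openin_open_trans by blast
qed

lemma continuous_map_chart: "continuous_map (subtopology X (chart_dom c)) euclidean (chart_map c)"
  using c continuous_map_in_subtopology homeomorphic_imp_continuous_map unfolding chart_on_def by blast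

lemma continuous_map_chart_inv: "continuous_map (top_of_set (chart_img c)) X (chart_inv c)"
proof -
  have h: "homeomorphic_map (subtopology X (chart_dom c)) (top_of_set (chart_img c)) (chart_map c)"
    using c by (simp add: chart_on_def)
  then obtain k where k: "homeomorphic_maps (subtopology X (chart_dom c)) (top_of_set (chart_img c)) (chart_map c) k"
    by (auto simp: homeomorphic_map_maps)
  have "k y = chart_inv c y" if "y \<in> topspace (top_of_set (chart_img c))" for y
  proof -
    have "k y \<in> chart_dom c" "chart_map c (k y) = y"
      using k that topspace_chart_dom unfolding homeomorphic_maps_def continuous_map_def by auto
    then show ?thesis by (metis chart_inv_map)
  qed
  moreover have "continuous_map (top_of_set (chart_img c)) X k"
    using k continuous_map_in_subtopology unfolding homeomorphic_maps_def by blast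
  ultimately show ?thesis by (rule continuous_map_eq[rotated])
qed

lemma openin_chart_inv_image:
  assumes "open V" "V \<subseteq> chart_img c"
  shows "openin X (chart_inv c ` V)"
proof -
  have "openin (subtopology X (chart_dom c)) {p \<in> topspace (subtopology X (chart_dom c)). chart_map c p \<in> V}"
    using continuous_map_chart assms(1) by (intro openin_continuous_map_preimage) auto
  also have "{p \<in> topspace (subtopology X (chart_dom c)). chart_map c p \<in> V} = chart_inv c ` V"
  proof
    show "{p \<in> topspace (subtopology X (chart_dom c)). chart_map c p \<in> V} \<subseteq> chart_inv c ` V"
    proof
      fix p assume "p \<in> {p \<in> topspace (subtopology X (chart_dom c)). chart_map c p \<in> V}"
      then have "p \<in> chart_dom c" "chart_map c p \<in> V" by (simp_all add: topspace_chart_dom)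
      then show "p \<in> chart_inv c ` V" using chart_inv_map[of p] by (intro image_eqI) auto
    qed
    show "chart_inv c ` V \<subseteq> {p \<in> topspace (subtopology X (chart_dom c)). chart_map c p \<in> V}"
    proof
      fix p assume "p \<in> chart_inv c ` V"
      then obtain x where x: "x \<in> V" "p = chart_inv c x" by blast
      then have "x \<in> chart_img c" using assms(2) by blast
      then show "p \<in> {p \<in> topspace (subtopology X (chart_dom c)). chart_map c p \<in> V}"
        using x chart_map_inv chart_inv_dom unfolding topspace_chart_dom by simp
    qed
  qed
  finally show ?thesis using c by (simp add: openin_open_subtopology chart_on_def)
qed

lemma connectedin_chart_inv_image:
  assumes "connected V" "V \<subseteq> chart_img c"
  shows "connectedin X (chart_inv c ` V)"
  using assms by (intro connectedin_continuous_map_image[OF continuous_map_chart_inv])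
    (simp add: connectedin_subtopology)

end

section \<open>Transition maps, coordinate vectors and the metric matrix\<close>

lemma transition_at:
  assumes "chart_on X c" "p \<in> chart_dom c"
  shows "transition c d (chart_map c p) = chart_map d p"
  using chart_inv_map[OF assms] by (simp add: transition_def)

lemma transition_differentiable:
  assumes M: "smooth_manifold X A" and "c \<in> A" "d \<in> A" "p \<in> chart_dom c \<inter> chart_dom d"
  shows "transition c d differentiable (at (chart_map c p))"
  using assms by (intro smooth_on_differentiable[of "chart_map c ` (chart_dom c \<inter> chart_dom d)"])
    (auto simp: smooth_manifold_def)

lemma transition_self:
  assumes "chart_on X c" "p \<in> chart_dom c"
  shows "frechet_derivative (transition c c) (at (chart_map c p)) v = v"
proof -
  have "((\<lambda>x. x) has_derivative (\<lambda>v. v)) (at (chart_map c p))" by (rule has_derivative_ident)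
  then have "(transition c c has_derivative (\<lambda>v. v)) (at (chart_map c p))"
    by (rule has_derivative_transform_within_open[OF _ open_chart_img[OF assms(1)] chart_map_img[OF assms]])
      (simp add: transition_def chart_map_inv[OF assms(1)])
  then show ?thesis by (metis frechet_derivative_at)
qed

text \<open>The cocycle rule. Transitions compose on the image of the triple overlap, which is open,
  so the chain rule at one point carries over to the direct transition. Coordinate vectors are
  tangent vectors for this reason.\<close>

lemma transition_chain:
  assumes M: "smooth_manifold X A" and A: "c \<in> A" "d \<in> A" "e \<in> A"
    and p: "p \<in> chart_dom c" "p \<in> chart_dom d" "p \<in> chart_dom e"
  shows "frechet_derivative (transition c e) (at (chart_map c p)) v =
     frechet_derivative (transition d e) (at (chart_map d p))
       (frechet_derivative (transition c d) (at (chart_map c p)) v)"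
proof -
  have ch: "chart_on X c" "chart_on X d" "chart_on X e" using M A by (auto simp: smooth_manifold_def)
  let ?x = "chart_map c p"
  let ?V = "chart_map c ` (chart_dom c \<inter> (chart_dom d \<inter> chart_dom e))"
  have "(transition c d has_derivative frechet_derivative (transition c d) (at ?x)) (at ?x)"
    using transition_differentiable[OF M A(1,2)] p frechet_derivative_works by blast
  moreover have "(transition d e has_derivative frechet_derivative (transition d e) (at (chart_map d p)))
      (at (transition c d ?x))"
    using transition_differentiable[OF M A(2,3)] p frechet_derivative_works transition_at[OF ch(1) p(1)] by auto
  ultimately have "((\<lambda>x. transition d e (transition c d x)) has_derivative
     (\<lambda>v. frechet_derivative (transition d e) (at (chart_map d p)) (frechet_derivative (transition c d) (at ?x) v))) (at ?x)"
    by (rule has_derivative_compose)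
  moreover have "open ?V"
    using ch by (intro open_chart_image[OF ch(1)] openin_Int) (auto simp: chart_on_def)
  moreover have "?x \<in> ?V" using p by auto
  moreover have "transition d e (transition c d x) = transition c e x" if "x \<in> ?V" for x
    using that by (auto simp: transition_def chart_inv_map[OF ch(1)] chart_inv_map[OF ch(2)])
  ultimately have "(transition c e has_derivative
     (\<lambda>v. frechet_derivative (transition d e) (at (chart_map d p)) (frechet_derivative (transition c d) (at ?x) v))) (at ?x)"
    by (rule has_derivative_transform_within_open)
  then show ?thesis by (metis frechet_derivative_at)
qed

lemma coord_vec_tangent:
  assumes M: "smooth_manifold X A" and A: "c \<in> A" and p: "p \<in> chart_dom c"
  shows "coord_vec A c p i \<in> tangent_space A p"
  unfolding tangent_space_def mem_Collect_eq
proof (intro conjI ballI allI impI)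
  fix d assume "\<not> (d \<in> A \<and> p \<in> chart_dom d)"
  then show "coord_vec A c p i d = 0" by (auto simp: coord_vec_def)
next
  fix d e assume "d \<in> A" "e \<in> A" "p \<in> chart_dom d \<inter> chart_dom e"
  then show "coord_vec A c p i e = frechet_derivative (transition d e) (at (chart_map d p)) (coord_vec A c p i d)"
    using transition_chain[OF M A _ _ p, of d e "axis i 1"] by (simp add: coord_vec_def)
qed

lemma coord_vec_self:
  assumes "chart_on X c" "c \<in> A" "p \<in> chart_dom c"
  shows "coord_vec A c p i c = axis i 1"
  using assms transition_self[OF assms(1,3)] by (simp add: coord_vec_def)

lemma tangent_space_comb:
  assumes M: "smooth_manifold X A" and "\<xi> \<in> tangent_space A p" "\<zeta> \<in> tangent_space A p"
  shows "tvec_comb a \<xi> b \<zeta> \<in> tangent_space A p"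
proof -
  have lin: "frechet_derivative (transition c d) (at (chart_map c p)) (a *\<^sub>R v + b *\<^sub>R w) =
      a *\<^sub>R frechet_derivative (transition c d) (at (chart_map c p)) v +
      b *\<^sub>R frechet_derivative (transition c d) (at (chart_map c p)) w"
    if "c \<in> A" "d \<in> A" "p \<in> chart_dom c \<inter> chart_dom d" for c d v w
    using linear_frechet_derivative[OF transition_differentiable[OF M that]]
    by (simp add: linear_add linear_cmul)
  show ?thesis
    unfolding tangent_space_def mem_Collect_eq tvec_comb_def
  proof (intro conjI ballI allI impI)
    fix c assume "\<not> (c \<in> A \<and> p \<in> chart_dom c)"
    then have "\<xi> c = 0" "\<zeta> c = 0" using assms(2,3) unfolding tangent_space_def by blast+
    then show "a *\<^sub>R \<xi> c + b *\<^sub>R \<zeta> c = 0" by simp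
  next
    fix c d assume cd: "c \<in> A" "d \<in> A" "p \<in> chart_dom c \<inter> chart_dom d"
    then have "\<xi> d = frechet_derivative (transition c d) (at (chart_map c p)) (\<xi> c)"
        "\<zeta> d = frechet_derivative (transition c d) (at (chart_map c p)) (\<zeta> c)"
      using assms(2,3) unfolding tangent_space_def by blast+
    then show "a *\<^sub>R \<xi> d + b *\<^sub>R \<zeta> d =
        frechet_derivative (transition c d) (at (chart_map c p)) (a *\<^sub>R \<xi> c + b *\<^sub>R \<zeta> c)"
      by (simp only: lin[OF cd])
  qed
qed

text \<open>For \<open>J = UNIV\<close> this is the tangent vector with coordinates
  \<open>v\<close>. Partial index sets allow it to be built by induction with
  \<open>tvec_comb\<close>, the operation for which linearity of metrics is formulated.\<close>

definition tangent_of_coords ::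
  "('a, 'n::finite) chart set \<Rightarrow> ('a, 'n) chart \<Rightarrow> 'a \<Rightarrow> real^'n \<Rightarrow> 'n set \<Rightarrow> ('a, 'n) tvec" where
  "tangent_of_coords A c p v J = (\<lambda>d. \<Sum>i\<in>J. v $ i *\<^sub>R coord_vec A c p i d)"

lemma tangent_of_coords_insert:
  "finite J \<Longrightarrow> i \<notin> J \<Longrightarrow> tangent_of_coords A c p v (insert i J) =
     tvec_comb (v $ i) (coord_vec A c p i) 1 (tangent_of_coords A c p v J)"
  by (simp add: tangent_of_coords_def tvec_comb_def)

lemma zero_tangent:
  assumes M: "smooth_manifold X A"
  shows "(\<lambda>c. 0) \<in> tangent_space A p"
  using linear_0[OF linear_frechet_derivative[OF transition_differentiable[OF M]]]
  by (simp add: tangent_space_def)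

lemma tangent_of_coords_tangent:
  assumes M: "smooth_manifold X A" and A: "c \<in> A" and p: "p \<in> chart_dom c"
  shows "tangent_of_coords A c p v J \<in> tangent_space A p"
proof -
  have "finite J" by simp
  then show ?thesis
  proof induction
    case empty
    then show ?case using zero_tangent[OF M] by (simp add: tangent_of_coords_def)
  next
    case (insert i J)
    then show ?case
      using tangent_space_comb[OF M coord_vec_tangent[OF assms]] by (simp add: tangent_of_coords_insert)
  qed
qed

lemma metric_tangent_of_coords:
  assumes M: "smooth_manifold X A" and A: "c \<in> A" and p: "p \<in> chart_dom c" and pX: "p \<in> topspace X"
    and g: "riemannian_metric X A g" and \<xi>: "\<xi> \<in> tangent_space A p"
  shows "g p \<xi> (tangent_of_coords A c p v J) = (\<Sum>i\<in>J. v $ i * g p \<xi> (coord_vec A c p i))"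
proof -
  have lin: "g p \<xi> (tvec_comb a \<zeta> b \<omega>) = a * g p \<xi> \<zeta> + b * g p \<xi> \<omega>"
    if "\<zeta> \<in> tangent_space A p" "\<omega> \<in> tangent_space A p" for a b \<zeta> \<omega>
    using g pX \<xi> that unfolding riemannian_metric_def by blast
  have "finite J" by simp
  then show ?thesis
  proof induction
    case empty
    \<comment> \<open>The zero vector is presented as a combination with zero coefficients, so that
      the linearity axiom applies.\<close>
    have "g p \<xi> (tvec_comb 0 \<xi> 0 \<xi>) = 0" using lin[OF \<xi> \<xi>] by simp
    then show ?case by (simp add: tvec_comb_def tangent_of_coords_def)
  next
    case (insert i J)
    then show ?case
      by (simp add: tangent_of_coords_insert lin coord_vec_tangent[OF M A p] tangent_of_coords_tangent[OF M A p])
  qed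
qed

text \<open>The quadratic form of the matrix at \<open>v\<close> is the squared length of the
  tangent vector with coordinates \<open>v\<close>, which is nonzero because its representative in
  \<open>c\<close> is \<open>v\<close>. Linearity is assumed in the second argument of
  \<open>g\<close>; symmetry transfers it to the first.\<close>

lemma metric_comp_pos_def:
  assumes M: "smooth_manifold X A" and A: "c \<in> A" and g: "riemannian_metric X A g"
    and x: "x \<in> chart_img c"
  shows "pos_def_matrix (metric_comp A c g x)"
proof -
  have ch: "chart_on X c" using M A by (auto simp: smooth_manifold_def)
  define p where "p = chart_inv c x"
  have p: "p \<in> chart_dom c" using chart_inv_dom[OF ch x] by (simp add: p_def)
  have pX: "p \<in> topspace X" using p chart_dom_subset[OF ch] by blast
  note tan = coord_vec_tangent[OF M A p]
  have sym: "g p \<xi> \<zeta> = g p \<zeta> \<xi>" if "\<xi> \<in> tangent_space A p" "\<zeta> \<in> tangent_space A p" for \<xi> \<zeta>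
    using g pX that unfolding riemannian_metric_def by blast
  have "transpose (metric_comp A c g x) = metric_comp A c g x"
    using sym tan by (simp add: transpose_def metric_comp_def vec_eq_iff p_def)
  moreover have "v \<bullet> (metric_comp A c g x *v v) > 0" if "v \<noteq> 0" for v
  proof -
    let ?\<xi> = "tangent_of_coords A c p v UNIV"
    have T: "?\<xi> \<in> tangent_space A p" by (rule tangent_of_coords_tangent[OF M A p])
    have "?\<xi> c = v"
      using basis_expansion[of v] coord_vec_self[OF ch A p]
      by (simp add: tangent_of_coords_def scalar_mult_eq_scaleR)
    then have "?\<xi> \<noteq> (\<lambda>c. 0)" using that by metis
    then have "g p ?\<xi> ?\<xi> > 0" using g pX T unfolding riemannian_metric_def by blast
    also have "g p ?\<xi> ?\<xi> = (\<Sum>i\<in>UNIV. v $ i * g p (coord_vec A c p i) ?\<xi>)"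
      using metric_tangent_of_coords[OF M A p pX g T] sym[OF T tan] by simp
    also have "\<dots> = v \<bullet> (metric_comp A c g x *v v)"
      using metric_tangent_of_coords[OF M A p pX g tan]
      by (simp add: quadratic_form_sum metric_comp_def p_def sum_distrib_left mult_ac)
    finally show ?thesis .
  qed
  ultimately show ?thesis by (simp add: pos_def_matrix_def)
qed

section \<open>The potential of the difference\<close>

text \<open>The relation df = \<omega>' - \<omega> read in coordinates. Second derivatives of
  \<open>f\<close> are then those of the components of the forms, and exchanging the two forms
  amounts to replacing \<open>f\<close> by its negative.\<close>

definition potential_difference ::
  "('a, 'n::finite) chart set \<Rightarrow> ('a, 'n) form \<Rightarrow> ('a, 'n) form \<Rightarrow> ('a \<Rightarrow> real) \<Rightarrow> bool" where
  "potential_difference A \<omega> \<omega>' f \<longleftrightarrow> (\<forall>c\<in>A. \<forall>x\<in>chart_img c.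
     ((\<lambda>y. f (chart_inv c y)) has_derivative (\<lambda>v. (form_comp A c \<omega>' x - form_comp A c \<omega> x) \<bullet> v)) (at x))"

text \<open>Members of one class are cohomologous to a common representative
  \<open>\<omega>\<close>, which cancels in the difference of the two potentials. The second part
  recovers the difference of the forms on every tangent vector from their components in one
  chart.\<close>

lemma is_differential_diff:
  assumes M: "smooth_manifold X A"
    and f: "smooth_function A f0" "smooth_function A f1"
    and d: "is_differential A f0 (\<lambda>p \<xi>. \<omega>0 p \<xi> - \<omega> p \<xi>)" "is_differential A f1 (\<lambda>p \<xi>. \<omega>1 p \<xi> - \<omega> p \<xi>)"
    and c: "c \<in> A" and p: "p \<in> chart_dom c" and x: "x = chart_map c p"
  shows "((\<lambda>y. f1 (chart_inv c y) - f0 (chart_inv c y)) has_derivative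
           (\<lambda>v. (form_comp A c \<omega>1 x - form_comp A c \<omega>0 x) \<bullet> v)) (at x)"
    and "\<xi> \<in> tangent_space A p \<Longrightarrow> \<omega>1 p \<xi> - \<omega>0 p \<xi> = (form_comp A c \<omega>1 x - form_comp A c \<omega>0 x) \<bullet> \<xi> c"
proof -
  have ch: "chart_on X c" using M c by (auto simp: smooth_manifold_def)
  have xi: "x \<in> chart_img c" using chart_map_img[OF ch p] by (simp add: x)
  have px: "chart_inv c x = p" using chart_inv_map[OF ch p] by (simp add: x)
  define D where "D v = frechet_derivative (f1 \<circ> chart_inv c) (at x) v - frechet_derivative (f0 \<circ> chart_inv c) (at x) v" for v
  have "smooth_on (chart_img c) (f0 \<circ> chart_inv c)" "smooth_on (chart_img c) (f1 \<circ> chart_inv c)"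
    using f c by (auto simp: smooth_function_def)
  then have "(f0 \<circ> chart_inv c) differentiable (at x)" "(f1 \<circ> chart_inv c) differentiable (at x)"
    using xi smooth_on_differentiable by blast+
  then have "((\<lambda>y. (f1 \<circ> chart_inv c) y - (f0 \<circ> chart_inv c) y) has_derivative D) (at x)"
    unfolding D_def frechet_derivative_works by (rule has_derivative_diff[rotated])
  then have der: "((\<lambda>y. f1 (chart_inv c y) - f0 (chart_inv c y)) has_derivative D) (at x)" by simp
  then have lin: "linear D" by (rule has_derivative_linear)
  have diff: "\<omega>1 p \<xi> - \<omega>0 p \<xi> = D (\<xi> c)" if "\<xi> \<in> tangent_space A p" for \<xi>
  proof -
    have "\<omega>0 p \<xi> - \<omega> p \<xi> = frechet_derivative (f0 \<circ> chart_inv c) (at x) (\<xi> c)"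
         "\<omega>1 p \<xi> - \<omega> p \<xi> = frechet_derivative (f1 \<circ> chart_inv c) (at x) (\<xi> c)"
      using d c p that unfolding is_differential_def x by blast+
    then show ?thesis by (simp add: D_def)
  qed
  have axis: "D (axis i 1) = (form_comp A c \<omega>1 x - form_comp A c \<omega>0 x) $ i" for i
    using diff[OF coord_vec_tangent[OF M c p, of i]] coord_vec_self[OF ch c p, of i]
    by (simp add: form_comp_def px)
  have "D v = (form_comp A c \<omega>1 x - form_comp A c \<omega>0 x) \<bullet> v" for v
  proof -
    have "D v = D (\<Sum>i\<in>UNIV. v $ i *\<^sub>R axis i 1)"
      using basis_expansion[of v] by (simp add: scalar_mult_eq_scaleR)
    also have "\<dots> = (\<Sum>i\<in>UNIV. v $ i * D (axis i 1))"
      using lin by (simp add: linear_sum linear_cmul)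
    finally show ?thesis
      by (simp add: axis inner_vec_def mult.commute)
  qed
  then have D: "D = (\<lambda>v. (form_comp A c \<omega>1 x - form_comp A c \<omega>0 x) \<bullet> v)" by auto
  show "((\<lambda>y. f1 (chart_inv c y) - f0 (chart_inv c y)) has_derivative
           (\<lambda>v. (form_comp A c \<omega>1 x - form_comp A c \<omega>0 x) \<bullet> v)) (at x)"
    using der unfolding D .
  show "\<omega>1 p \<xi> - \<omega>0 p \<xi> = (form_comp A c \<omega>1 x - form_comp A c \<omega>0 x) \<bullet> \<xi> c" if "\<xi> \<in> tangent_space A p"
    using diff[OF that] unfolding D .
qed

lemma lagrangian_angle_eq:
  "lagrangian_angle A g \<omega> c x = rel_angle (metric_comp A c g x) (cov_deriv (metric_comp A c g) (form_comp A c \<omega>) x)"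
  by (simp add: lagrangian_angle_def rel_angle_def Let_def)

lemma closed_one_form_chart:
  assumes "closed_one_form X A \<omega>" "c \<in> A"
  shows "smooth_on (chart_img c) (\<lambda>x. form_comp A c \<omega> x $ j)"
    and "x \<in> chart_img c \<Longrightarrow>
       partial i (\<lambda>y. form_comp A c \<omega> y $ j) x = partial j (\<lambda>y. form_comp A c \<omega> y $ i) x"
  using assms by (auto simp: closed_one_form_def one_form_def)

lemma metric_comp_smooth:
  "riemannian_metric X A g \<Longrightarrow> c \<in> A \<Longrightarrow> smooth_on (chart_img c) (\<lambda>x. metric_comp A c g x $ i $ j)"
  by (auto simp: riemannian_metric_def)

lemma lagrangian_angle_at_max:
  assumes M: "smooth_manifold X A" and g: "riemannian_metric X A g"
    and \<omega>0: "closed_one_form X A \<omega>0" and \<omega>1: "closed_one_form X A \<omega>1"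
    and f: "potential_difference A \<omega>0 \<omega>1 f"
    and c: "c \<in> A" and p: "p \<in> chart_dom c" and max: "\<And>q. q \<in> topspace X \<Longrightarrow> f q \<le> f p"
  shows "lagrangian_angle A g \<omega>1 c (chart_map c p) \<le> lagrangian_angle A g \<omega>0 c (chart_map c p)"
  unfolding lagrangian_angle_eq
proof (rule chart_angle_at_max[where U = "chart_img c" and F = "\<lambda>y. f (chart_inv c y)"])
  have ch: "chart_on X c" using M c by (auto simp: smooth_manifold_def)
  show "open (chart_img c)" by (rule open_chart_img[OF ch])
  show "chart_map c p \<in> chart_img c" by (rule chart_map_img[OF ch p])
  fix x assume x: "x \<in> chart_img c"
  show "pos_def_matrix (metric_comp A c g x)" by (rule metric_comp_pos_def[OF M c g x])
  show "((\<lambda>y. f (chart_inv c y)) has_derivative (\<lambda>v. (form_comp A c \<omega>1 x - form_comp A c \<omega>0 x) \<bullet> v)) (at x)"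
    using f c x by (simp add: potential_difference_def)
  have "chart_inv c x \<in> topspace X" using chart_inv_dom[OF ch x] chart_dom_subset[OF ch] by blast
  then show "f (chart_inv c x) \<le> f (chart_inv c (chart_map c p))"
    using max chart_inv_map[OF ch p] by simp
qed (use closed_one_form_chart[OF \<omega>0 c] closed_one_form_chart[OF \<omega>1 c] in auto)

text \<open>Maximality is assumed only over an open \<open>W\<close>, since on a disconnected
  manifold a component has its own maximum.\<close>

lemma potential_locally_constant:
  assumes M: "smooth_manifold X A" and g: "riemannian_metric X A g"
    and \<omega>0: "closed_one_form X A \<omega>0" and \<omega>1: "closed_one_form X A \<omega>1"
    and f: "potential_difference A \<omega>0 \<omega>1 f"
    and angle: "\<And>c x. c \<in> A \<Longrightarrow> x \<in> chart_img c \<Longrightarrow> lagrangian_angle A g \<omega>1 c x = lagrangian_angle A g \<omega>0 c x"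
    and W: "openin X W" "p \<in> W" and max: "\<And>q. q \<in> W \<Longrightarrow> f q \<le> f p"
  shows "\<exists>N. openin X N \<and> p \<in> N \<and> N \<subseteq> W \<and> (\<forall>q\<in>N. f q = f p)"
proof -
  have "p \<in> topspace X" using W openin_subset by blast
  then obtain c where c: "c \<in> A" and p: "p \<in> chart_dom c" using M unfolding smooth_manifold_def by blast
  have ch: "chart_on X c" using M c by (auto simp: smooth_manifold_def)
  define V where "V = chart_map c ` (chart_dom c \<inter> W)"
  have V: "open V" unfolding V_def
    using W(1) ch by (intro open_chart_image[OF ch] openin_Int) (auto simp: chart_on_def)
  have VU: "V \<subseteq> chart_img c" unfolding V_def chart_img_def by blast
  have VW: "chart_inv c x \<in> W" if "x \<in> V" for x
    using that chart_inv_map[OF ch] by (auto simp: V_def)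
  let ?x = "chart_map c p"
  have xV: "?x \<in> V" using p W by (auto simp: V_def)
  have px: "chart_inv c ?x = p" by (rule chart_inv_map[OF ch p])
  have "\<exists>r>0. \<forall>x\<in>ball ?x r. f (chart_inv c x) = f (chart_inv c ?x)"
  proof (rule chart_strong_maximum[where U = "chart_img c" and V = V and G = "metric_comp A c g"
        and ?w0.0 = "form_comp A c \<omega>0" and ?w1.0 = "form_comp A c \<omega>1"])
    show "open (chart_img c)" by (rule open_chart_img[OF ch])
    show "smooth_on (chart_img c) (\<lambda>x. metric_comp A c g x $ i $ j)" for i j
      by (rule metric_comp_smooth[OF g c])
    show "f (chart_inv c x) \<le> f (chart_inv c ?x)" if "x \<in> V" for x
      unfolding px by (rule max[OF VW[OF that]])
    fix x assume x: "x \<in> chart_img c"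
    show "pos_def_matrix (metric_comp A c g x)" by (rule metric_comp_pos_def[OF M c g x])
    show "((\<lambda>y. f (chart_inv c y)) has_derivative (\<lambda>v. (form_comp A c \<omega>1 x - form_comp A c \<omega>0 x) \<bullet> v)) (at x)"
      using f c x by (simp add: potential_difference_def)
    show "rel_angle (metric_comp A c g x) (cov_deriv (metric_comp A c g) (form_comp A c \<omega>1) x) =
          rel_angle (metric_comp A c g x) (cov_deriv (metric_comp A c g) (form_comp A c \<omega>0) x)"
      using angle[OF c x] by (simp add: lagrangian_angle_eq)
  qed (use closed_one_form_chart[OF \<omega>0 c] closed_one_form_chart[OF \<omega>1 c] V VU xV in auto)
  then obtain r where r: "r > 0" "\<And>x. x \<in> ball ?x r \<Longrightarrow> f (chart_inv c x) = f p"
    unfolding px by blast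
  let ?N = "chart_inv c ` (V \<inter> ball ?x r)"
  have "openin X ?N" using V VU by (intro openin_chart_inv_image[OF ch]) auto
  moreover have "p \<in> ?N" using px xV r(1) by (metis IntI centre_in_ball image_eqI)
  moreover have "?N \<subseteq> W" using VW by blast
  moreover have "\<forall>q\<in>?N. f q = f p" using r(2) by blast
  ultimately show ?thesis by blast
qed

lemma potential_continuous:
  assumes M: "smooth_manifold X A" and f: "potential_difference A \<omega>0 \<omega>1 f"
  shows "continuous_map X euclideanreal f"
  unfolding continuous_map_def
proof (intro conjI allI impI)
  fix U :: "real set" assume "openin euclidean U"
  then have U: "open U" by simp
  show "openin X {p \<in> topspace X. f p \<in> U}"
  proof (subst openin_subopen, intro ballI)
    fix p assume p: "p \<in> {p \<in> topspace X. f p \<in> U}"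
    then obtain c where c: "c \<in> A" and pc: "p \<in> chart_dom c" using M unfolding smooth_manifold_def by blast
    have ch: "chart_on X c" using M c by (auto simp: smooth_manifold_def)
    let ?V = "{x \<in> chart_img c. f (chart_inv c x) \<in> U}"
    have "continuous_on (chart_img c) (\<lambda>y. f (chart_inv c y))"
      using f c has_derivative_continuous unfolding potential_difference_def
      by (intro continuous_at_imp_continuous_on) blast
    then have V: "open ?V"
      using continuous_open_preimage[OF _ open_chart_img[OF ch] U] by (simp add: vimage_def Int_def)
    have "openin X (chart_inv c ` ?V)" by (rule openin_chart_inv_image[OF ch V]) blast
    moreover have "p \<in> chart_inv c ` ?V"
      using p pc chart_inv_map[OF ch pc] chart_map_img[OF ch pc]
      by (intro image_eqI[of _ _ "chart_map c p"]) auto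
    moreover have "chart_inv c ` ?V \<subseteq> {p \<in> topspace X. f p \<in> U}"
      using chart_inv_dom[OF ch] chart_dom_subset[OF ch] by blast
    ultimately show "\<exists>T. openin X T \<and> p \<in> T \<and> T \<subseteq> {p \<in> topspace X. f p \<in> U}" by blast
  qed
qed auto

section \<open>From local to global\<close>

lemma compactin_attains_max:
  assumes "compactin X K" "K \<noteq> {}" "continuous_map X euclideanreal f"
  obtains p where "p \<in> K" "\<And>q. q \<in> K \<Longrightarrow> f q \<le> f p"
proof -
  have "compact (f ` K)" using image_compactin[OF assms(1,3)] by simp
  then obtain s where "s \<in> f ` K" "\<And>t. t \<in> f ` K \<Longrightarrow> t \<le> s"
    using compact_attains_sup[of "f ` K"] assms(2) by blast
  with that show ?thesis by blast
qed

text \<open>Coordinate balls are connected neighbourhoods, so a manifold is locally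
  connected.\<close>

lemma openin_component_manifold:
  assumes M: "smooth_manifold X A"
  shows "openin X (connected_component_of_set X q)"
proof (subst openin_subopen, intro ballI)
  fix p assume p: "p \<in> connected_component_of_set X q"
  then have "p \<in> topspace X" 
    using connected_component_of_subset_topspace[of X q] by blast
  then obtain c where c: "c \<in> A" and pc: "p \<in> chart_dom c" using M unfolding smooth_manifold_def by blast
  have ch: "chart_on X c" using M c by (auto simp: smooth_manifold_def)
  obtain r where r: "r > 0" "ball (chart_map c p) r \<subseteq> chart_img c"
    using open_chart_img[OF ch] chart_map_img[OF ch pc] open_contains_ball by blast
  let ?T = "chart_inv c ` ball (chart_map c p) r"
  have pT: "p \<in> ?T" using chart_inv_map[OF ch pc] r by (intro image_eqI[of _ _ "chart_map c p"]) auto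
  have "?T \<subseteq> connected_component_of_set X p"
    by (rule connected_component_of_maximal[OF connectedin_chart_inv_image[OF ch connected_ball r(2)] pT])
  moreover have "connected_component_of_set X p = connected_component_of_set X q"
    using p by (metis connected_component_of_equiv mem_Collect_eq)
  ultimately show "\<exists>T. openin X T \<and> p \<in> T \<and> T \<subseteq> connected_component_of_set X q"
    using openin_chart_inv_image[OF ch open_ball r(2)] pT by blast
qed

text \<open>A component is closed in the compact space, so the potential has a maximum on it. The
  set where the maximum is attained is closed by continuity and open by the strong maximum
  principle, hence the whole component.\<close>

lemma potential_constant_near:
  assumes M: "smooth_manifold X A" and comp: "compact_space X" and g: "riemannian_metric X A g"
    and \<omega>0: "closed_one_form X A \<omega>0" and \<omega>1: "closed_one_form X A \<omega>1"
    and f: "potential_difference A \<omega>0 \<omega>1 f"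
    and angle: "\<And>c x. c \<in> A \<Longrightarrow> x \<in> chart_img c \<Longrightarrow> lagrangian_angle A g \<omega>1 c x = lagrangian_angle A g \<omega>0 c x"
    and q: "q \<in> topspace X"
  shows "\<exists>N. openin X N \<and> q \<in> N \<and> (\<forall>p\<in>N. f p = f q)"
proof -
  let ?K = "connected_component_of_set X q"
  have cont: "continuous_map X euclideanreal f" by (rule potential_continuous[OF M f])
  have oK: "openin X ?K" by (rule openin_component_manifold[OF M])
  have cK: "closedin X ?K" by (rule closedin_connected_component_of)
  have qK: "q \<in> ?K" using q by (simp add: connected_component_of_refl)
  obtain m where m: "m \<in> ?K" "\<And>p. p \<in> ?K \<Longrightarrow> f p \<le> f m"
    using compactin_attains_max[OF closedin_compact_space[OF comp cK] _ cont] qK by blast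
  define E where "E = ?K \<inter> {p \<in> topspace X. f p \<in> {f m}}"
  have cE: "closedin X E"
    unfolding E_def using cont by (intro closedin_Int cK closedin_continuous_map_preimage) auto
  have "openin X E"
  proof (subst openin_subopen, intro ballI)
    fix p assume p: "p \<in> E"
    then have pK: "p \<in> ?K" and fp: "f p = f m" by (auto simp: E_def)
    have max: "f s \<le> f p" if "s \<in> ?K" for s using m(2)[OF that] fp by simp
    obtain N where N: "openin X N" "p \<in> N" "N \<subseteq> ?K" "\<forall>s\<in>N. f s = f p"
      using potential_locally_constant[OF M g \<omega>0 \<omega>1 f angle oK pK max] by blast
    then have "N \<subseteq> E" using fp openin_subset[OF N(1)] by (auto simp: E_def)
    then show "\<exists>T. openin X T \<and> p \<in> T \<and> T \<subseteq> E" using N by blast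
  qed
  with cE have "?K \<subseteq> E \<or> disjnt ?K E"
    by (intro connectedin_clopen_cases[OF connectedin_connected_component_of])
  moreover have "m \<in> E" using m(1) connected_component_of_subset_topspace[of X q] by (auto simp: E_def)
  ultimately have "?K \<subseteq> E" using m(1) by (auto simp: disjnt_iff)
  then have "f p = f m" if "p \<in> ?K" for p using that unfolding E_def by blast
  then have "f p = f q" if "p \<in> ?K" for p using that qK by metis
  then show ?thesis using oK qK by blast
qed

lemma special_lagrangian_forms_eq:
  assumes M: "smooth_manifold X A" and comp: "compact_space X" and g: "riemannian_metric X A g"
    and \<omega>0: "closed_one_form X A \<omega>0" and \<omega>1: "closed_one_form X A \<omega>1"
    and f: "potential_difference A \<omega>0 \<omega>1 f"
    and sl: "special_lagrangian_graph A g \<omega>0" "special_lagrangian_graph A g \<omega>1"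
    and c: "c \<in> A" and p: "p \<in> chart_dom c"
  shows "form_comp A c \<omega>1 (chart_map c p) = form_comp A c \<omega>0 (chart_map c p)"
proof -
  have ch: "chart_on X c" if "c \<in> A" for c using M that by (auto simp: smooth_manifold_def)
  obtain \<theta>0 where \<theta>0: "\<And>c x. c \<in> A \<Longrightarrow> x \<in> chart_img c \<Longrightarrow> lagrangian_angle A g \<omega>0 c x = \<theta>0"
    using sl(1) unfolding special_lagrangian_graph_def by blast
  obtain \<theta>1 where \<theta>1: "\<And>c x. c \<in> A \<Longrightarrow> x \<in> chart_img c \<Longrightarrow> lagrangian_angle A g \<omega>1 c x = \<theta>1"
    using sl(2) unfolding special_lagrangian_graph_def by blast
  have pX: "p \<in> topspace X" using p chart_dom_subset[OF ch[OF c]] by blast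
  \<comment> \<open>Formulated for an arbitrary pair because it is used twice: for the given
    potential, and with the forms exchanged for its negative, whose maximum is the minimum of the
    potential.\<close>
  have le: "\<theta>' \<le> \<theta>"
    if \<omega>: "closed_one_form X A \<omega>" "closed_one_form X A \<omega>'" "potential_difference A \<omega> \<omega>' h"
      and \<theta>: "\<And>c x. c \<in> A \<Longrightarrow> x \<in> chart_img c \<Longrightarrow> lagrangian_angle A g \<omega> c x = \<theta>"
      and \<theta>': "\<And>c x. c \<in> A \<Longrightarrow> x \<in> chart_img c \<Longrightarrow> lagrangian_angle A g \<omega>' c x = \<theta>'"
    for \<omega> \<omega>' h \<theta> \<theta>'
  proof -
    have "compactin X (topspace X)" using comp by (simp add: compact_space_def)
    then obtain m where m: "m \<in> topspace X" "\<And>q. q \<in> topspace X \<Longrightarrow> h q \<le> h m"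
      using compactin_attains_max[of X "topspace X" h] potential_continuous[OF M \<omega>(3)] pX by blast
    obtain d where d: "d \<in> A" "m \<in> chart_dom d" using m(1) M unfolding smooth_manifold_def by blast
    have "chart_map d m \<in> chart_img d" by (rule chart_map_img[OF ch[OF d(1)] d(2)])
    with lagrangian_angle_at_max[OF M g \<omega> d m(2)] show ?thesis using \<theta> \<theta>' d(1) by simp
  qed
  have "potential_difference A \<omega>1 \<omega>0 (\<lambda>p. - f p)"
    unfolding potential_difference_def
  proof (intro ballI)
    fix c x assume "c \<in> A" "x \<in> chart_img c"
    then have "((\<lambda>y. f (chart_inv c y)) has_derivative (\<lambda>v. (form_comp A c \<omega>1 x - form_comp A c \<omega>0 x) \<bullet> v)) (at x)"
      using f by (simp add: potential_difference_def)
    then have "((\<lambda>y. - f (chart_inv c y)) has_derivative (\<lambda>v. - ((form_comp A c \<omega>1 x - form_comp A c \<omega>0 x) \<bullet> v))) (at x)"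
      by (rule has_derivative_minus)
    then show "((\<lambda>y. - f (chart_inv c y)) has_derivative (\<lambda>v. (form_comp A c \<omega>0 x - form_comp A c \<omega>1 x) \<bullet> v)) (at x)"
      by (simp add: inner_diff_left)
  qed
  then have "\<theta>0 \<le> \<theta>1" using le[OF \<omega>1 \<omega>0 _ \<theta>1 \<theta>0] by blast
  moreover have "\<theta>1 \<le> \<theta>0" using le[OF \<omega>0 \<omega>1 f \<theta>0 \<theta>1] by blast
  ultimately have "lagrangian_angle A g \<omega>1 c x = lagrangian_angle A g \<omega>0 c x"
    if "c \<in> A" "x \<in> chart_img c" for c x using \<theta>0[OF that] \<theta>1[OF that] by simp
  from potential_constant_near[OF M comp g \<omega>0 \<omega>1 f this pX]
  obtain N where N: "openin X N" "p \<in> N" "\<forall>q\<in>N. f q = f p" by blast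
  let ?x = "chart_map c p"
  let ?V = "chart_map c ` (chart_dom c \<inter> N)"
  have V: "open ?V"
    using N(1) ch[OF c] by (intro open_chart_image[OF ch[OF c]] openin_Int) (auto simp: chart_on_def)
  have xV: "?x \<in> ?V" using p N by blast
  \<comment> \<open>Constancy near \<open>p\<close> gives the potential the derivative 0 there;
    uniqueness of derivatives makes the difference of the components orthogonal to every vector,
    itself included.\<close>
  have "((\<lambda>y. f (chart_inv c y)) has_derivative (\<lambda>v. 0)) (at ?x)"
  proof (rule has_derivative_transform_within_open[OF has_derivative_const V xV])
    show "f p = f (chart_inv c y)" if "y \<in> ?V" for y
      using that N(3) chart_inv_map[OF ch[OF c]] by force
  qed
  moreover have "((\<lambda>y. f (chart_inv c y)) has_derivative (\<lambda>v. (form_comp A c \<omega>1 ?x - form_comp A c \<omega>0 ?x) \<bullet> v)) (at ?x)"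
    using f c chart_map_img[OF ch[OF c] p] by (simp add: potential_difference_def)
  ultimately have "(\<lambda>v. (form_comp A c \<omega>1 ?x - form_comp A c \<omega>0 ?x) \<bullet> v) = (\<lambda>v. 0)"
    using has_derivative_unique by metis
  then have "(form_comp A c \<omega>1 ?x - form_comp A c \<omega>0 ?x) \<bullet> (form_comp A c \<omega>1 ?x - form_comp A c \<omega>0 ?x) = 0"
    by metis
  then show ?thesis by simp
qed

theorem theorem2p17:
  fixes X :: "'a topology"
    and A :: "('a, 'n::finite) chart set"
    and g :: "('a, 'n) bilinear_field"
    and \<chi>\<^sub>0 \<chi>\<^sub>1 :: "('a, 'n) form"
    and h :: "('a, 'n) form set"
  assumes "compact_riemannian_manifold X A g"
    and "closed_one_form X A \<chi>\<^sub>0" and "closed_one_form X A \<chi>\<^sub>1"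
    and "h \<in> deRham_H1 X A" and "\<chi>\<^sub>0 \<in> h" and "\<chi>\<^sub>1 \<in> h"
    and "special_lagrangian_graph A g \<chi>\<^sub>0" and "special_lagrangian_graph A g \<chi>\<^sub>1"
  shows "\<chi>\<^sub>0 = \<chi>\<^sub>1"
proof -
  have M: "smooth_manifold X A" and comp: "compact_space X" and g: "riemannian_metric X A g"
    using assms(1) by (auto simp: compact_riemannian_manifold_def)
  \<comment> \<open>A cohomology class is an equivalence class of some representative
    \<open>\<omega>\<close>, to which both forms are compared.\<close>
  obtain \<omega> where "(\<omega>, \<chi>\<^sub>0) \<in> cohomologous X A" "(\<omega>, \<chi>\<^sub>1) \<in> cohomologous X A"
    using assms(4-6) unfolding deRham_H1_def by (auto elim!: quotientE)
  then obtain f0 f1 where f: "smooth_function A f0" "smooth_function A f1"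
    and d: "is_differential A f0 (\<lambda>p \<xi>. \<chi>\<^sub>0 p \<xi> - \<omega> p \<xi>)" "is_differential A f1 (\<lambda>p \<xi>. \<chi>\<^sub>1 p \<xi> - \<omega> p \<xi>)"
    unfolding cohomologous_def by blast
  have ch: "chart_on X c" if "c \<in> A" for c using M that by (auto simp: smooth_manifold_def)
  have pot: "potential_difference A \<chi>\<^sub>0 \<chi>\<^sub>1 (\<lambda>p. f1 p - f0 p)"
    unfolding potential_difference_def
  proof (intro ballI)
    fix c x assume c: "c \<in> A" and x: "x \<in> chart_img c"
    show "((\<lambda>y. f1 (chart_inv c y) - f0 (chart_inv c y)) has_derivative
        (\<lambda>v. (form_comp A c \<chi>\<^sub>1 x - form_comp A c \<chi>\<^sub>0 x) \<bullet> v)) (at x)"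
      by (rule is_differential_diff(1)[OF M f d c chart_inv_dom[OF ch[OF c] x] chart_map_inv[OF ch[OF c] x, symmetric]])
  qed
  show ?thesis
  proof (intro ext)
    fix p \<xi>
    show "\<chi>\<^sub>0 p \<xi> = \<chi>\<^sub>1 p \<xi>"
    proof (cases "p \<in> topspace X \<and> \<xi> \<in> tangent_space A p")
      case True
      then obtain c where c: "c \<in> A" and p: "p \<in> chart_dom c" using M unfolding smooth_manifold_def by blast
      have "\<chi>\<^sub>1 p \<xi> - \<chi>\<^sub>0 p \<xi> = (form_comp A c \<chi>\<^sub>1 (chart_map c p) - form_comp A c \<chi>\<^sub>0 (chart_map c p)) \<bullet> \<xi> c"
        using is_differential_diff(2)[OF M f d c p refl] True by blast
      also have "\<dots> = 0"
        using special_lagrangian_forms_eq[OF M comp g assms(2,3) pot assms(7,8) c p] by simp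
      finally show ?thesis by simp
    next
      \<comment> \<open>Off the tangent bundle both forms vanish by convention.\<close>
      case False
      then show ?thesis using assms(2,3) unfolding closed_one_form_def one_form_def by metis
    qed
  qed
qed

end
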